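(* Let $u^{\epsilon}$ be an optimal control of problem $(P_\epsilon)$ for $\epsilon\in(0,\epsilon_{\max})$, with corresponding state $\theta^{\epsilon}$ and costate $p^{\epsilon}$ satisfying the optimality conditions (a)-(c) given in the context. Suppose that these optimal solutions can be expressed as series in the small parameter $\epsilon$: for $t\in[0,T]$, as $\epsilon\to 0^+$, $$\theta^{\epsilon}(t)=\theta^{0}(t)+\epsilon\,\theta^{1}(t)+\mathcal{O}(\epsilon^2),\quad p^{\epsilon}(t)=p^{0}(t)+\epsilon\,p^{1}(t)+\mathcal{O}(\epsilon^2),\quad u^{\epsilon}(t)=u^{0}(t)+\epsilon\,u^{1}(t)+\mathcal{O}(\epsilon^2).$$ Then the optimal value of $(P_\epsilon)$ satisfies $$J^{\epsilon}[u^{\epsilon}]=\Phi\bigl(\theta^{0}(T),\mathcal{Z}^{(2)}\bigr)+\epsilon\bigl\langle\nabla\Phi\bigl(\theta^{0}(T),\mathcal{Z}^{(2)}\bigr),\theta^{1}(T)\bigr\rangle+\mathcal{O}(\epsilon^2)=\Phi\bigl(\theta^{0}(T),\mathcal{Z}^{(2)}\bigr)-\epsilon\bigl\langle p^{0}(T),\theta^{1}(T)\bigr\rangle+\mathcal{O}(\epsilon^2),$$ where the zeroth-order solutions $\theta^0,p^0,u^0$ satisfy $$\dot\theta^{0}(t)=-\nabla J_0\bigl(\theta^{0}(t),\mathcal{Z}^{(1)}\bigr),\qquad \theta^{0}(0)=\theta_0,$$ $$\dot p^{0}(t)=\nabla^2J_0\bigl(\theta^{0}(t),\mathcal{Z}^{(1)}\bigr)\,p^{0}(t),\qquad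 p^{0}(T)=-\nabla\Phi\bigl(\theta^{0}(T),\mathcal{Z}^{(2)}\bigr),$$ $$u^{0}(t)\in\operatorname*{arg\,max}_{u\in U}\bigl\langle p^{0}(t),\,u\,B\bigl(\theta^{0}(t),\tilde{\mathcal{Z}}^{(1)}\bigr)\bigr\rangle,\qquad t\in[0,T],$$ and the first-order solution $\theta^{1}$ satisfies $$\dot\theta^{1}(t)=-\nabla^2J_0\bigl(\theta^{0}(t),\mathcal{Z}^{(1)}\bigr)\theta^{1}(t)+u^{0}(t)\,B\bigl(\theta^{0}(t),\tilde{\mathcal{Z}}^{(1)}\bigr),\qquad \theta^{1}(0)=0,\quad t\in[0,T].$$ Moreover, the estimated optimal parameter $\theta^{\ast}=\theta^{\epsilon}(T)$ is given by $\theta^{\ast}=\theta^{0}(T)+\epsilon\,\theta^{1}(T)+\mathcal{O}(\epsilon^2)$.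
   Context: Data and functions. $\mathcal{Z}^{(k)}=\{(x^{(k)}_i,y^{(k)}_i)\}_{i=1}^{m_k}$, $k=1,2$, are two given finite datasets (training and validating), and $\tilde{\mathcal{Z}}^{(1)}=\{(x^{(1)}_i,\tilde y^{(1)}_i)\}_{i=1}^{m_1}$ with $\tilde y^{(1)}_i=y^{(1)}_i+\varepsilon_i$, where $\varepsilon_i$ is a (fixed) realization of $\mathcal{N}(0,\sigma^2)$ noise with small variance; all three datasets are fixed. Parameters $\theta=(\theta_1,\dots,\theta_p)$ range over $\Theta\subset\mathbb{R}^p$ (open), $h_\theta$ is a parametrized family of hypothesis functions, and $\ell$ is a loss function. For $\mathcal{Z}=\{(x_i,y_i)\}_{i=1}^{m_1}$, equal to $\mathcal{Z}^{(1)}$ or $\tilde{\mathcal{Z}}^{(1)}$, put $J_0(\theta,\mathcal{Z})=\frac1{m_1}\sum_{i=1}^{m_1}\ell\bigl(h_\theta(x_i),y_i\bigr)$, assumed twice continuously differentiable in $\theta$. Gradients $\nabla$ and Hessians $\nabla^2$ are taken with respect to $\theta$; $\nabla B$ is the Jacobian matrix of $B$ in $\theta$; $\langle\cdot,\cdot\rangle$ is the Euclidean inner product. Define $$B(\theta,\tilde{\mathcal{Z}}^{(1)})=\Bigl[\bigl(\partial J_0(\theta,\tilde{\mathcal{Z}}^{(1)})/\partial\theta_1\bigr)^2,\dots,\bigl(\partial J_0(\theta,\tilde{\mathcal{Z}}^{(1)})/\partial\theta_p\bigr)^2\Bigr]^T .$$ $\Phi(\theta,\mathcal{Z}^{(2)})$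 is a scalar function (in the paper, $\Phi(\theta,\mathcal{Z}^{(2)})=\frac1{m_2}\sum_{i=1}^{m_2}\ell(h_\theta(x^{(2)}_i),y^{(2)}_i)$). Optimal control problem $(P_\epsilon)$. Fix $T>0$, $\theta_0\in\Theta$, $U\subset\mathbb{R}$ and $\epsilon_{\max}>0$. A control $u:[0,T]\to\mathbb{R}$ is admissible if it is measurable and $u(t)\in U$ for all $t\in[0,T]$. For $\epsilon\in(0,\epsilon_{\max})$, problem $(P_\epsilon)$ is to minimize, over admissible controls $u$, the functional $J^\epsilon[u]=\Phi\bigl(\theta^\epsilon(T),\mathcal{Z}^{(2)}\bigr)$, where $\theta^\epsilon$ solves $$\dot\theta^\epsilon(t)=-\nabla J_0\bigl(\theta^\epsilon(t),\mathcal{Z}^{(1)}\bigr)+\epsilon\,u(t)\,B\bigl(\theta^\epsilon(t),\tilde{\mathcal{Z}}^{(1)}\bigr),\qquad \theta^\epsilon(0)=\theta_0 .$$ (Differential equations with a merely measurable control are understood in the usual almost-everywhere sense with absolutely continuous solutions.) Standing assumptions: (i) $U$ is compact and $T$ is fixed; (ii) $\Phi(\cdot,\mathcal{Z}^{(2)})$ is twice continuously differentiable in $\theta$; (iii) for every $\epsilon\in(0,\epsilon_{\max})$ and every admissible bounded control $u$, the solution $\theta^\epsilon(t)$, $t\in[0,T]$, of the system $\dot\theta^\epsilon(t)=-\nabla J_0\bigl(\theta^\epsilon(t),\mathcal{Z}^{(1)}\bigr)+\epsilon\,u(t)\,B\bigl(\theta^\epsilon(t),\tilde{\mathcal{Z}}^{(1)}\bigr)$,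 $\theta^\epsilon(0)=\theta_0$, exists and is bounded; (iv) an admissible optimal control $u^\epsilon$ exists for every $\epsilon\in(0,\epsilon_{\max})$. Optimality conditions (Pontryagin's maximum principle). With Hamiltonian $H^\epsilon(\theta,p,u)=\langle p,-\nabla J_0(\theta,\mathcal{Z}^{(1)})+\epsilon uB(\theta,\tilde{\mathcal{Z}}^{(1)})\rangle$, the triple $(\theta^\epsilon,p^\epsilon,u^\epsilon)$ satisfies (a) $\dot\theta^\epsilon=-\nabla J_0(\theta^\epsilon,\mathcal{Z}^{(1)})+\epsilon u^\epsilon B(\theta^\epsilon,\tilde{\mathcal{Z}}^{(1)})$, $\theta^\epsilon(0)=\theta_0$; (b) $\dot p^\epsilon=\nabla^2J_0(\theta^\epsilon,\mathcal{Z}^{(1)})p^\epsilon-\epsilon u^\epsilon\bigl(\nabla B(\theta^\epsilon,\tilde{\mathcal{Z}}^{(1)})\bigr)^Tp^\epsilon$, $p^\epsilon(T)=-\nabla\Phi(\theta^\epsilon(T),\mathcal{Z}^{(2)})$; (c) $u^\epsilon(t)\in\operatorname*{arg\,max}_{u\in U}H^\epsilon\bigl(\theta^\epsilon(t),p^\epsilon(t),u\bigr)$ for $t\in[0,T]$. All $\mathcal{O}(\cdot)$ are as $\epsilon\to0^+$; the expansions of $\theta^\epsilon(t),p^\epsilon(t),u^\epsilon(t)$ are understood for each $t\in[0,T]$.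
   Formalization: The formal statement additionally assumes that the zeroth-order state θ^0(t) lies in the open set Θ for every t in [0,T]; otherwise the limit can reach the boundary of Θ, where ∇J_0(θ^0(t)) is undefined. This is automatic when Θ = R^p. *)

theory Defs
  imports "HOL-Analysis.Analysis" "HOL-Library.Landau_Symbols"
begin

type_synonym 'x dataset = "('x \<times> real) list"

definition perturb_labels :: "'x dataset \<Rightarrow> real list \<Rightarrow> 'x dataset" where
  "perturb_labels Z es = map2 (\<lambda>(x, y) e. (x, y + e)) Z es"

definition emp_risk ::
  "('o \<Rightarrow> real \<Rightarrow> real) \<Rightarrow> (real^'p \<Rightarrow> 'x \<Rightarrow> 'o) \<Rightarrow> 'x dataset \<Rightarrow> real^'p \<Rightarrow> real" where
  "emp_risk l h Z \<theta> = (1 / real (length Z)) * (\<Sum>i<length Z. l (h \<theta> (fst (Z ! i))) (snd (Z ! i)))"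

text \<open>The gradient is the vector of partial derivatives, each being the Frechet derivative
  applied to a coordinate vector; it is only used where the function is differentiable.\<close>

definition grad :: "(real^'p \<Rightarrow> real) \<Rightarrow> real^'p \<Rightarrow> real^'p" where
  "grad f x = (\<chi> i. frechet_derivative f (at x) (axis i 1))"

definition hessian :: "(real^'p \<Rightarrow> real) \<Rightarrow> real^'p \<Rightarrow> real^'p^'p" where
  "hessian f x = jacobian (grad f) (at x)"

definition C2_on :: "(real^'p) set \<Rightarrow> (real^'p \<Rightarrow> real) \<Rightarrow> bool" where
  "C2_on S f \<longleftrightarrow> (\<forall>x\<in>S. f differentiable (at x)) \<and> (\<forall>x\<in>S. grad f differentiable (at x)) \<and>
     continuous_on S (hessian f)"

definition sq_grad :: "(real^'p \<Rightarrow> real) \<Rightarrow> real^'p \<Rightarrow> real^'p" where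
  "sq_grad f x = (\<chi> i. (grad f x $ i)\<^sup>2)"

text \<open>Absolute continuity on a compact interval. A division is a finite family of compact
  intervals with disjoint interiors; the degenerate members contribute \<open>0\<close> to both sums.\<close>

definition abs_continuous_on_interval ::
  "real \<Rightarrow> real \<Rightarrow> (real \<Rightarrow> 'a::real_normed_vector) \<Rightarrow> bool" where
  "abs_continuous_on_interval a b f \<longleftrightarrow>
     (\<forall>e>0. \<exists>d>0. \<forall>D S. D division_of S \<and> S \<subseteq> {a..b} \<and> (\<Sum>K\<in>D. Sup K - Inf K) < d \<longrightarrow>
        (\<Sum>K\<in>D. norm (f (Sup K) - f (Inf K))) < e)"

definition ae_ode_solution ::
  "real \<Rightarrow> (real \<Rightarrow> 'a \<Rightarrow> 'a) \<Rightarrow> (real \<Rightarrow> 'a::real_normed_vector) \<Rightarrow> bool" where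
  "ae_ode_solution T F x \<longleftrightarrow> abs_continuous_on_interval 0 T x \<and>
     (AE t in lebesgue_on {0..T}. (x has_vector_derivative F t (x t)) (at t within {0..T}))"

definition admissible :: "real \<Rightarrow> real set \<Rightarrow> (real \<Rightarrow> real) \<Rightarrow> bool" where
  "admissible T U u \<longleftrightarrow> u \<in> borel_measurable (lebesgue_on {0..T}) \<and> (\<forall>t\<in>{0..T}. u t \<in> U)"

text \<open>Below, \<open>J\<close> and \<open>Jn\<close> are the empirical risks on the clean and on the noisy training data,
  and \<open>\<phi>\<close> is the terminal cost.\<close>

definition control_field ::
  "(real^'p \<Rightarrow> real) \<Rightarrow> (real^'p \<Rightarrow> real) \<Rightarrow> real \<Rightarrow> real \<Rightarrow> real^'p \<Rightarrow> real^'p" where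
  "control_field J Jn \<epsilon> v \<theta> = - grad J \<theta> + (\<epsilon> * v) *\<^sub>R sq_grad Jn \<theta>"

definition is_state ::
  "(real^'p) set \<Rightarrow> real \<Rightarrow> real^'p \<Rightarrow> (real^'p \<Rightarrow> real) \<Rightarrow> (real^'p \<Rightarrow> real) \<Rightarrow> real \<Rightarrow>
   (real \<Rightarrow> real) \<Rightarrow> (real \<Rightarrow> real^'p) \<Rightarrow> bool" where
  "is_state \<Theta> T \<theta>init J Jn \<epsilon> u \<theta> \<longleftrightarrow>
     (\<forall>t\<in>{0..T}. \<theta> t \<in> \<Theta>) \<and> \<theta> 0 = \<theta>init \<and>
     ae_ode_solution T (\<lambda>t. control_field J Jn \<epsilon> (u t)) \<theta>"

text \<open>The functional \<open>J\<^sup>\<epsilon>[u]\<close>. Only the restriction of a state to \<open>{0..T}\<close> is determined by the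
  control, hence the description selects the terminal value rather than the state function.\<close>

definition cost ::
  "(real^'p) set \<Rightarrow> real \<Rightarrow> real^'p \<Rightarrow> (real^'p \<Rightarrow> real) \<Rightarrow> (real^'p \<Rightarrow> real) \<Rightarrow>
   (real^'p \<Rightarrow> real) \<Rightarrow> real \<Rightarrow> (real \<Rightarrow> real) \<Rightarrow> real" where
  "cost \<Theta> T \<theta>init J Jn \<phi> \<epsilon> u = \<phi> (THE x. \<exists>\<theta>. is_state \<Theta> T \<theta>init J Jn \<epsilon> u \<theta> \<and> x = \<theta> T)"

definition optimal_control ::
  "(real^'p) set \<Rightarrow> real \<Rightarrow> real^'p \<Rightarrow> (real^'p \<Rightarrow> real) \<Rightarrow> (real^'p \<Rightarrow> real) \<Rightarrow>
   (real^'p \<Rightarrow> real) \<Rightarrow> real set \<Rightarrow> real \<Rightarrow> (real \<Rightarrow> real) \<Rightarrow> bool" where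
  "optimal_control \<Theta> T \<theta>init J Jn \<phi> U \<epsilon> u \<longleftrightarrow>
     is_arg_min (cost \<Theta> T \<theta>init J Jn \<phi> \<epsilon>) (admissible T U) u"

definition hamiltonian ::
  "(real^'p \<Rightarrow> real) \<Rightarrow> (real^'p \<Rightarrow> real) \<Rightarrow> real \<Rightarrow> real^'p \<Rightarrow> real^'p \<Rightarrow> real \<Rightarrow> real" where
  "hamiltonian J Jn \<epsilon> \<theta> p v = p \<bullet> control_field J Jn \<epsilon> v \<theta>"

definition costate_field ::
  "(real^'p \<Rightarrow> real) \<Rightarrow> (real^'p \<Rightarrow> real) \<Rightarrow> real \<Rightarrow> real \<Rightarrow> real^'p \<Rightarrow> real^'p \<Rightarrow> real^'p" where
  "costate_field J Jn \<epsilon> v \<theta> p =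
     hessian J \<theta> *v p - (\<epsilon> * v) *\<^sub>R (transpose (jacobian (sq_grad Jn) (at \<theta>)) *v p)"

definition pontryagin_conditions ::
  "(real^'p) set \<Rightarrow> real \<Rightarrow> real^'p \<Rightarrow> (real^'p \<Rightarrow> real) \<Rightarrow> (real^'p \<Rightarrow> real) \<Rightarrow>
   (real^'p \<Rightarrow> real) \<Rightarrow> real set \<Rightarrow> real \<Rightarrow> (real \<Rightarrow> real^'p) \<Rightarrow> (real \<Rightarrow> real^'p) \<Rightarrow>
   (real \<Rightarrow> real) \<Rightarrow> bool" where
  "pontryagin_conditions \<Theta> T \<theta>init J Jn \<phi> U \<epsilon> \<theta> p u \<longleftrightarrow>
     is_state \<Theta> T \<theta>init J Jn \<epsilon> u \<theta> \<and>
     ae_ode_solution T (\<lambda>t. costate_field J Jn \<epsilon> (u t) (\<theta> t)) p \<and> p T = - grad \<phi> (\<theta> T) \<and>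
     (\<forall>t\<in>{0..T}. is_arg_max (hamiltonian J Jn \<epsilon> (\<theta> t) (p t)) (\<lambda>v. v \<in> U) (u t))"

text \<open>\<open>f \<epsilon> = f0 + \<epsilon> f1 + O(\<epsilon>\<^sup>2)\<close> as \<open>\<epsilon>\<close> tends to \<open>0\<close> from the right; the norm is there because
  Landau symbols are only available for field-valued functions.\<close>

definition first_order_expansion ::
  "(real \<Rightarrow> 'a::real_normed_vector) \<Rightarrow> 'a \<Rightarrow> 'a \<Rightarrow> bool" where
  "first_order_expansion f f0 f1 \<longleftrightarrow>
     (\<lambda>\<epsilon>. norm (f \<epsilon> - (f0 + \<epsilon> *\<^sub>R f1))) \<in> O[at_right 0](\<lambda>\<epsilon>. \<epsilon>\<^sup>2)"

end

theory Submission
  imports Defs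
begin

text \<open>The expansion hypotheses are pointwise in \<open>t\<close>, whereas the conclusions are differential
  equations. The bridge is compactness. Suppose that curves \<open>x \<epsilon>\<close> with almost-everywhere velocities
  \<open>g \<epsilon>\<close> converge at every single time to points of an open set, and that the velocities are bounded,
  uniformly in \<open>\<epsilon>\<close>, while the curves stay in a given compact subset. A curve that is close to its
  limit at a time \<open>s\<close> then stays in a ball around that limit for a duration that does not depend on
  \<open>\<epsilon>\<close>, and finitely many such time intervals cover \<open>[0, T]\<close>. Hence, for all small \<open>\<epsilon>\<close>, all curves
  lie in one compact set and all velocities obey one bound (\<open>primitive_on_family_bounded\<close>). If the
  velocities converge pointwise as well, then dominated convergence passes to the limit in
  \<open>x \<epsilon> b - x \<epsilon> a = \<integral> g \<epsilon>\<close> (\<open>primitive_on_limit\<close>).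

  This argument is used three times: for the states, which gives the equation of \<open>\<theta>0\<close>; for the
  costates, which gives the equation of \<open>p0\<close>; and for the difference quotients
  \<open>(\<theta> \<epsilon> - \<theta>0) / \<epsilon>\<close>, whose pointwise limit is \<open>\<theta>1\<close> and whose velocities converge to the right-hand
  side of the linearised equation.

  Two facts of real analysis relate almost-everywhere solutions to integral equations: an absolutely
  continuous function is the integral of its almost-everywhere derivative
  (\<open>abs_continuous_has_integral\<close>), and an indefinite integral is differentiable almost everywhere with
  the integrand as its derivative (\<open>indefinite_integral_ae_has_vector_derivative\<close>).

  The remaining claims are pointwise. The maximum condition for \<open>u0\<close> is the limit of the one for
  \<open>u \<epsilon>\<close>, after the terms without control are cancelled and the rest is divided by \<open>\<epsilon>\<close>. The expansion
  of the cost is the second-order Taylor estimate of \<open>\<Phi>\<close> at \<open>\<theta>0 T\<close>; the cost of \<open>u \<epsilon>\<close> is indeed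
  \<open>\<Phi>\<close> at \<open>\<theta> \<epsilon> T\<close>, because the state of a bounded control is unique (\<open>cost_eq\<close>).\<close>

section \<open>Absolutely continuous functions are integrals of their derivatives\<close>

text \<open>The interiors of the members of a division are pairwise disjoint.\<close>

lemma sum_length_division_le:
  fixes D :: "real set set"
  assumes D: "D division_of S" and "S \<subseteq> O'" and O': "O' \<in> lmeasurable"
  shows "(\<Sum>K\<in>D. Sup K - Inf K) \<le> measure lebesgue O'"
proof -
  have K: "\<exists>u v. K = {u..v} \<and> u \<le> v" if "K \<in> D" for K
    using division_ofD(3,4)[OF D that] by (metis atLeastatMost_empty_iff box_real(2))
  have len: "Sup K - Inf K = measure lebesgue (interior K)" if "K \<in> D" for K
    using K[OF that] by (auto simp: interior_atLeastAtMost_real)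
  have meas: "interior K \<in> lmeasurable" if "K \<in> D" for K
    using K[OF that] by (auto simp: interior_atLeastAtMost_real)
  have fin: "finite D" using D by auto
  have "(\<Sum>K\<in>D. Sup K - Inf K) = (\<Sum>K\<in>D. measure lebesgue (interior K))"
    using len by auto
  also have "\<dots> = measure lebesgue (\<Union>K\<in>D. interior K)"
    using D by (intro measure_UNION'[symmetric] fin meas)
      (auto simp: pairwise_def disjnt_def dest: division_ofD(5))
  also have "\<dots> \<le> measure lebesgue O'"
  proof (rule measure_mono_fmeasurable[OF _ _ O'])
    show "(\<Union>K\<in>D. interior K) \<subseteq> O'"
      using division_ofD(2)[OF D] \<open>S \<subseteq> O'\<close> interior_subset by blast
    show "(\<Union>K\<in>D. interior K) \<in> sets lebesgue"
      using meas fin by (intro sets.finite_UN) (auto intro: fmeasurableD)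
  qed
  finally show ?thesis .
qed

lemma negligible_outer_open:
  fixes N :: "real set"
  assumes "negligible N" "0 < d"
  obtains G where "open G" "N \<subseteq> G" "G \<in> lmeasurable" "measure lebesgue G < d"
proof -
  have N: "N \<in> lmeasurable" "measure lebesgue N = 0"
    using assms by (auto simp: negligible_iff_measure)
  obtain G where G: "open G" "N \<subseteq> G" "G - N \<in> lmeasurable" "emeasure lebesgue (G - N) < ennreal d"
    using sets_lebesgue_outer_open[OF _ assms(2), of N] N by (auto intro: fmeasurableD)
  have eq: "G = (G - N) \<union> N" using G by auto
  have Gm: "G \<in> lmeasurable" using G(3) N(1) eq by (metis fmeasurable.Un)
  have "measure lebesgue G \<le> measure lebesgue (G - N) + measure lebesgue N"
    using measure_Un_le[of "G - N" lebesgue N] eq G(3) N(1) by (metis fmeasurableD)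
  also have "\<dots> < d"
    using G(4) N(2) \<open>0 < d\<close> G(3) by (simp add: emeasure_eq_measure2 ennreal_less_iff)
  finally show thesis using that G Gm by blast
qed

text \<open>The gauge treats two kinds of tags differently. Off the null set \<open>N\<close> it is fine enough for the
  derivative to approximate the increment of \<open>f\<close> on the tagged interval. At a tag in \<open>N\<close> it confines
  the interval to an open set of small measure, so that absolute continuity makes the total increment
  over all of those intervals small.\<close>

lemma abs_continuous_has_integral:
  fixes f :: "real \<Rightarrow> 'a::euclidean_space"
  assumes ac: "abs_continuous_on_interval c d f" and ab: "c \<le> a" "a \<le> b" "b \<le> d"
    and N: "negligible N"
    and deriv: "\<And>t. t \<in> {c..d} - N \<Longrightarrow> (f has_vector_derivative f' t) (at t within {c..d})"
  shows "(f' has_integral f b - f a) {a..b}"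
proof -
  \<comment> \<open>With the value \<open>0\<close> on \<open>N\<close>, tags in \<open>N\<close> contribute only the increment of \<open>f\<close> to the error.\<close>
  define g where "g t = (if t \<in> N then 0 else f' t)" for t
  have sub: "{a..b} \<subseteq> {c..d}" using ab by auto
  have "(g has_integral f b - f a) {a..b}"
    unfolding has_integral_factor_content_real
  proof (intro allI impI)
    fix e :: real assume "e > 0"
    show "\<exists>\<gamma>. gauge \<gamma> \<and> (\<forall>p. p tagged_division_of {a..b} \<and> \<gamma> fine p \<longrightarrow>
        norm ((\<Sum>(x, k)\<in>p. measure lborel k *\<^sub>R g x) - (f b - f a)) \<le> e * measure lborel {a..b})"
    proof (cases "a = b")
      case True
      have 1: "norm ((\<Sum>(x, k)\<in>p. measure lborel k *\<^sub>R g x) - (f b - f a)) \<le> e * measure lborel {a..b}"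
        if "p tagged_division_of {a..b}" for p
        using sum_content_null[of a b p g] that True by (simp add: box_real)
      show ?thesis
        by (intro exI[of _ "\<lambda>x. ball x 1"] conjI allI impI gauge_ball 1) auto
    next
      case False
      with ab have "a < b" by auto
      \<comment> \<open>One half of the error is for the tags outside \<open>N\<close>, the other one for those in \<open>N\<close>.\<close>
      define e' where "e' = e / 2"
      have "e' > 0" using \<open>e > 0\<close> by (simp add: e'_def)
      have "e' * (b - a) > 0" using \<open>e' > 0\<close> \<open>a < b\<close> by simp
      with ac have "\<exists>\<delta>>0. \<forall>D S. D division_of S \<and> S \<subseteq> {c..d} \<and> (\<Sum>K\<in>D. Sup K - Inf K) < \<delta> \<longrightarrow>
          (\<Sum>K\<in>D. norm (f (Sup K) - f (Inf K))) < e' * (b - a)"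
        unfolding abs_continuous_on_interval_def by (elim allE[of _ "e' * (b - a)"] impE)
      then obtain \<delta> where "\<delta> > 0" and \<delta>: "\<And>D S. D division_of S \<Longrightarrow> S \<subseteq> {c..d} \<Longrightarrow>
          (\<Sum>K\<in>D. Sup K - Inf K) < \<delta> \<Longrightarrow> (\<Sum>K\<in>D. norm (f (Sup K) - f (Inf K))) < e' * (b - a)"
        by (elim exE conjE) blast
      obtain G where G: "open G" "N \<subseteq> G" "G \<in> lmeasurable" "measure lebesgue G < \<delta>"
        using negligible_outer_open[OF N \<open>\<delta> > 0\<close>] by blast
      have "\<forall>x. \<exists>r>0. x \<in> {a..b} - N \<longrightarrow>
          (\<forall>y\<in>{c..d}. norm (y - x) < r \<longrightarrow> norm (f y - f x - (y - x) *\<^sub>R f' x) \<le> e' * norm (y - x))"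
        using deriv[unfolded has_vector_derivative_def has_derivative_within_alt] \<open>e' > 0\<close> sub by blast
      then obtain r where r0: "\<And>x. 0 < r x" and r: "\<And>x y. x \<in> {a..b} - N \<Longrightarrow> y \<in> {c..d} \<Longrightarrow>
          norm (y - x) < r x \<Longrightarrow> norm (f y - f x - (y - x) *\<^sub>R f' x) \<le> e' * norm (y - x)"
        by metis
      define \<gamma> where "\<gamma> x = (if x \<in> N then G else ball x (r x))" for x
      have "gauge \<gamma>" using r0 G by (auto simp: gauge_def \<gamma>_def)
      moreover have "norm ((\<Sum>(x, k)\<in>p. measure lborel k *\<^sub>R g x) - (f b - f a)) \<le> e * measure lborel {a..b}"
        if p: "p tagged_division_of {a..b}" and fine: "\<gamma> fine p" for p
      proof -
        have fin: "finite p" using p by auto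
        define q where "q = {(x, K) \<in> p. x \<in> N}"
        have "q \<subseteq> p" by (auto simp: q_def)
        have K: "\<exists>u v. K = {u..v} \<and> u \<le> v \<and> u \<le> x \<and> x \<le> v \<and> {u..v} \<subseteq> {a..b}" if xK: "(x, K) \<in> p" for x K
        proof -
          obtain u v where "K = cbox u v" using tagged_division_ofD(4)[OF p xK] by blast
          then show ?thesis using tagged_division_ofD(2,3)[OF p xK] by (intro exI[of _ u] exI[of _ v]) auto
        qed
        have ba: "b - a = (\<Sum>(x, K)\<in>p. Sup K - Inf K)" "f b - f a = (\<Sum>(x, K)\<in>p. f (Sup K) - f (Inf K))"
          using additive_tagged_division_1[OF ab(2) p, of "\<lambda>x. x"] additive_tagged_division_1[OF ab(2) p, of f]
          by auto
        define w where "w = (\<lambda>(x, K). measure lborel K *\<^sub>R g x - (f (Sup K) - f (Inf K)))"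
        have "(\<Sum>(x, k)\<in>p. measure lborel k *\<^sub>R g x) - (f b - f a) = sum w p"
          by (simp add: ba(2) w_def case_prod_unfold sum_subtractf)
        also have "\<dots> = sum w (p - q) + sum w q"
          using sum.subset_diff[OF \<open>q \<subseteq> p\<close> fin] .
        finally have split: "(\<Sum>(x, k)\<in>p. measure lborel k *\<^sub>R g x) - (f b - f a) = sum w (p - q) + sum w q" .
        have "norm (sum w (p - q)) \<le> (\<Sum>(x, K)\<in>p - q. e' * (Sup K - Inf K))"
        proof (rule sum_norm_le, clarify)
          fix x K assume xK: "(x, K) \<in> p" "(x, K) \<notin> q"
          then have x: "x \<notin> N" by (auto simp: q_def)
          obtain u v where uv: "K = {u..v}" "u \<le> x" "x \<le> v" "{u..v} \<subseteq> {a..b}" using K[OF xK(1)] by blast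
          have "K \<subseteq> \<gamma> x" using fine xK by (auto simp: fine_def)
          moreover have "u \<in> K" "v \<in> K" using uv by auto
          ultimately have "u \<in> ball x (r x)" "v \<in> ball x (r x)" using x by (auto simp: \<gamma>_def)
          then have d: "norm (u - x) < r x" "norm (v - x) < r x" by (auto simp: dist_norm norm_minus_commute)
          have "u \<in> {c..d}" "v \<in> {c..d}" "x \<in> {a..b} - N" using uv sub x by auto
          then have 1: "norm (f u - f x - (u - x) *\<^sub>R f' x) \<le> e' * (x - u)"
              "norm (f v - f x - (v - x) *\<^sub>R f' x) \<le> e' * (v - x)"
            using r[of x u] r[of x v] d uv by auto
          have "w (x, K) = (f u - f x - (u - x) *\<^sub>R f' x) - (f v - f x - (v - x) *\<^sub>R f' x)"
            using uv x by (simp add: w_def g_def algebra_simps)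
          also have "norm \<dots> \<le> e' * (x - u) + e' * (v - x)"
            using 1 norm_triangle_ineq4[of "f u - f x - (u - x) *\<^sub>R f' x" "f v - f x - (v - x) *\<^sub>R f' x"]
            by linarith
          finally show "norm (w (x, K)) \<le> e' * (Sup K - Inf K)"
            using uv by (simp add: algebra_simps)
        qed
        also have "\<dots> \<le> (\<Sum>(x, K)\<in>p. e' * (Sup K - Inf K))"
        proof (rule sum_mono2[OF fin Diff_subset])
          fix z assume "z \<in> p - (p - q)"
          then obtain x K where z: "z = (x, K)" "(x, K) \<in> p" by (cases z) auto
          then have "Inf K \<le> Sup K" using K[of x K] by auto
          then show "0 \<le> (case z of (x, K) \<Rightarrow> e' * (Sup K - Inf K))" using \<open>e' > 0\<close> z by simp
        qed
        also have "\<dots> = e' * (b - a)"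
          by (simp add: ba(1) sum_distrib_left case_prod_unfold)
        finally have good: "norm (sum w (p - q)) \<le> e' * (b - a)" .
        have "q tagged_partial_division_of {a..b}"
          by (rule tagged_partial_division_subset[OF conjunct1[OF p[unfolded tagged_division_of_def]] \<open>q \<subseteq> p\<close>])
        then have qU: "q tagged_division_of \<Union>(snd ` q)" by (rule tagged_partial_division_of_Union_self)
        have D: "snd ` q division_of \<Union>(snd ` q)" using division_of_tagged_division[OF qU] .
        have UG: "\<Union>(snd ` q) \<subseteq> G" and Uc: "\<Union>(snd ` q) \<subseteq> {c..d}"
        proof -
          have "K \<subseteq> G \<and> K \<subseteq> {c..d}" if Kq: "K \<in> snd ` q" for K
          proof -
            obtain z where z: "z \<in> q" "K = snd z" using Kq by blast
            then have x: "(fst z, K) \<in> p" "fst z \<in> N" by (auto simp: q_def)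
            then have "K \<subseteq> G" using fineD[OF fine x(1)] by (simp add: \<gamma>_def)
            moreover have "K \<subseteq> {c..d}" using tagged_division_ofD(3)[OF p x(1)] sub by (rule order_trans)
            ultimately show ?thesis ..
          qed
          then show "\<Union>(snd ` q) \<subseteq> G" "\<Union>(snd ` q) \<subseteq> {c..d}" by (simp_all add: Union_least)
        qed
        have "(\<Sum>K\<in>snd ` q. norm (f (Sup K) - f (Inf K))) < e' * (b - a)"
          using \<delta>[OF D Uc] sum_length_division_le[OF D UG G(3)] G(4) by linarith
        moreover have "(\<Sum>(x, K)\<in>q. norm (f (Sup K) - f (Inf K))) = (\<Sum>K\<in>snd ` q. norm (f (Sup K) - f (Inf K)))"
        proof -
          \<comment> \<open>A degenerate interval may occur in \<open>q\<close> with several tags, so the sum over \<open>q\<close> reduces to one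
            over its intervals only for a summand that vanishes whenever the interior is empty.\<close>
          define \<phi> where "\<phi> K = (if K = {} then 0 else norm (f (Sup K) - f (Inf K)))" for K
          have ne: "K \<noteq> {}" if "(x, K) \<in> q" for x K
            using K[of x K] that by (auto simp: q_def)
          have 1: "(\<Sum>(x, K)\<in>q. \<phi> K) = (\<Sum>K\<in>snd ` q. \<phi> K)"
          proof (rule sum.over_tagged_division_lemma[OF qU])
            show "\<phi> (cbox u v) = 0" if "box u v = {}" for u v :: real
              using that by (cases "u = v") (auto simp: \<phi>_def)
          qed
          have 2: "(\<Sum>(x, K)\<in>q. \<phi> K) = (\<Sum>(x, K)\<in>q. norm (f (Sup K) - f (Inf K)))"
            using ne by (intro sum.cong) (auto simp: \<phi>_def)
          have 3: "(\<Sum>K\<in>snd ` q. \<phi> K) = (\<Sum>K\<in>snd ` q. norm (f (Sup K) - f (Inf K)))"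
            using ne by (intro sum.cong) (auto simp: \<phi>_def)
          show ?thesis using 1 2 3 by argo
        qed
        moreover have "norm (sum w q) \<le> (\<Sum>(x, K)\<in>q. norm (f (Sup K) - f (Inf K)))"
        proof (rule sum_norm_le, clarify)
          fix x K assume "(x, K) \<in> q"
          then show "norm (w (x, K)) \<le> norm (f (Sup K) - f (Inf K))"
            by (simp add: w_def g_def q_def norm_minus_commute)
        qed
        ultimately have "norm (sum w q) \<le> e' * (b - a)" by linarith
        then have "norm (sum w (p - q) + sum w q) \<le> e' * (b - a) + e' * (b - a)"
          using good norm_triangle_ineq[of "sum w (p - q)" "sum w q"] by linarith
        also have "\<dots> = e * measure lborel {a..b}" using ab by (simp add: e'_def field_simps)
        finally show ?thesis unfolding split .
      qed
      ultimately show ?thesis by (intro exI[of _ \<gamma>]) simp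
    qed
  qed
  then show ?thesis
    by (rule has_integral_spike[OF N, rotated]) (auto simp: g_def)
qed

section \<open>Almost-everywhere differentiability of indefinite integrals\<close>

text \<open>Lebesgue differentiation, obtained from the Henstock lemma. If differentiability fails at \<open>x\<close>,
  then arbitrarily short intervals with endpoint \<open>x\<close> have an error, in the approximation of the integral
  by a single Riemann term, that exceeds a fixed multiple of their length. By the Vitali covering
  theorem, disjoint intervals of this kind cover almost all of the exceptional set. The Henstock lemma
  bounds the sum of their errors by an arbitrarily small number, and hence also the sum of their lengths.\<close>

lemma indefinite_integral_ae_has_vector_derivative:
  fixes f :: "real \<Rightarrow> 'a::euclidean_space"
  assumes f: "f integrable_on {a..b}"
  obtains N where "negligible N" "\<And>t. t \<in> {a..b} - N \<Longrightarrow>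
    ((\<lambda>x. integral {a..x} f) has_vector_derivative f t) (at t within {a..b})"
proof -
  define F where "F x = integral {a..x} f" for x
  define R where "R x y = norm (F y - F x - (y - x) *\<^sub>R f x)" for x y
  \<comment> \<open>The points at which the difference quotients miss \<open>f x\<close> by more than \<open>c\<close> at arbitrarily small scales.\<close>
  define E where "E c = {x \<in> {a..b}. \<forall>d>0. \<exists>y\<in>{a..b}. \<bar>y - x\<bar> < d \<and> R x y > c * \<bar>y - x\<bar>}" for c
  have I: "integral {x..y} f = F y - F x" if "a \<le> x" "x \<le> y" "y \<le> b" for x y
    using Henstock_Kurzweil_Integration.integral_combine[of a x y f] integrable_subinterval_real[OF f, of a y] that
    by (simp add: F_def algebra_simps)
  have neg: "negligible (E c)" if "c > 0" for c
    unfolding negligible_outer_le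
  proof (intro allI impI)
    fix e :: real assume "e > 0"
    then have "e * c > 0" using \<open>c > 0\<close> by simp
    obtain \<gamma> where "gauge \<gamma>" and \<gamma>: "\<And>p. p tagged_partial_division_of {a..b} \<Longrightarrow> \<gamma> fine p \<Longrightarrow>
        (\<Sum>(x, k)\<in>p. norm (measure lborel k *\<^sub>R f x - integral k f)) < e * c"
      using Henstock_lemma[of f a b "e * c"] f \<open>e * c > 0\<close> by (auto simp: box_real)
    \<comment> \<open>A pair \<open>(x, y)\<close> stands for the interval between \<open>x\<close> and \<open>y\<close>, tagged with its endpoint \<open>x\<close>; as a
      closed ball it has centre \<open>m (x, y)\<close> and radius \<open>r (x, y)\<close>.\<close>
    define seg :: "real \<times> real \<Rightarrow> real set" where "seg = (\<lambda>(x, y). {min x y..max x y})"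
    define m :: "real \<times> real \<Rightarrow> real" where "m = (\<lambda>(x, y). (x + y) / 2)"
    define r :: "real \<times> real \<Rightarrow> real" where "r = (\<lambda>(x, y). \<bar>y - x\<bar> / 2)"
    define V where "V = {(x, y). x \<in> {a..b} \<and> y \<in> {a..b} \<and> x \<noteq> y \<and> seg (x, y) \<subseteq> \<gamma> x \<and> R x y > c * \<bar>y - x\<bar>}"
    have cb: "cball (m i) (r i) = seg i" for i
      by (cases i) (auto simp: m_def r_def seg_def dist_real_def min_def max_def abs_if field_simps split: if_splits)
    have V1: "0 < r i" if "i \<in> V" for i using that by (auto simp: V_def r_def)
    have V2: "\<exists>i. i \<in> V \<and> x \<in> cball (m i) (r i) \<and> r i < d" if "x \<in> E c" "0 < d" for x d
    proof -
      obtain \<rho> where \<rho>: "\<rho> > 0" "ball x \<rho> \<subseteq> \<gamma> x"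
        using \<open>gauge \<gamma>\<close> unfolding gauge_def by (meson openE)
      have "0 < min d \<rho>" using \<open>\<rho> > 0\<close> \<open>0 < d\<close> by simp
      moreover have "\<forall>d>0. \<exists>y\<in>{a..b}. \<bar>y - x\<bar> < d \<and> R x y > c * \<bar>y - x\<bar>"
        using that(1) by (simp add: E_def)
      ultimately obtain y where y: "y \<in> {a..b}" "\<bar>y - x\<bar> < min d \<rho>" "R x y > c * \<bar>y - x\<bar>"
        by blast
      have "x \<noteq> y" using y(3) by (auto simp: R_def)
      moreover have "seg (x, y) \<subseteq> \<gamma> x"
        using \<open>ball x \<rho> \<subseteq> \<gamma> x\<close> y(2) by (auto simp: seg_def subset_eq dist_real_def)
      ultimately have "(x, y) \<in> V" using that y by (auto simp: V_def E_def)
      moreover have "r (x, y) < d" using y(2) by (auto simp: r_def)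
      moreover have "x \<in> seg (x, y)" by (auto simp: seg_def)
      ultimately show ?thesis unfolding cb by blast
    qed
    obtain C where C: "countable C" "C \<subseteq> V" "pairwise (\<lambda>i j. disjnt (seg i) (seg j)) C"
      and negC: "negligible (E c - (\<Union>i\<in>C. seg i))"
      using Vitali_covering_theorem_cballs[of V r "E c" m, OF V1 V2] unfolding cb by metis
    have bound: "measure lebesgue (\<Union>i\<in>I. seg i) \<le> e" if "I \<subseteq> C" "finite I" for I
    proof -
      have R: "norm (measure lborel (seg i) *\<^sub>R f (fst i) - integral (seg i) f) = R (fst i) (snd i)"
        if "i \<in> V" for i
      proof (cases i)
        case (Pair x y)
        have xy: "a \<le> x" "x \<le> b" "a \<le> y" "y \<le> b" using that Pair by (auto simp: V_def)
        show ?thesis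
        proof (cases "x \<le> y")
          case True
          then have "measure lborel (seg i) = y - x" "integral (seg i) f = F y - F x"
            using I[of x y] xy by (auto simp: Pair seg_def)
          then show ?thesis by (simp add: Pair R_def norm_minus_commute)
        next
          case False
          then have eq: "measure lborel (seg i) = x - y" "integral (seg i) f = F x - F y"
            using I[of y x] xy by (auto simp: Pair seg_def)
          show ?thesis unfolding eq R_def by (simp add: Pair algebra_simps)
        qed
      qed
      define h where "h i = (fst i, seg i)" for i
      have h_in: "fst i \<in> seg i" for i by (cases i) (auto simp: seg_def)
      have inj: "inj_on h I"
      proof (rule inj_onI)
        fix i j assume ij: "i \<in> I" "j \<in> I" "h i = h j"
        then have "\<not> disjnt (seg i) (seg j)" using h_in[of i] by (auto simp: h_def disjnt_def)
        then show "i = j" using C(3) ij that unfolding pairwise_def by blast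
      qed
      have tag: "h ` I tagged_partial_division_of {a..b}"
        unfolding tagged_partial_division_of_def
      proof (intro conjI allI impI)
        show "finite (h ` I)" using that by simp
        fix x K assume "(x, K) \<in> h ` I"
        then obtain i where i: "i \<in> I" "x = fst i" "K = seg i" by (auto simp: h_def)
        then have "i \<in> V" using that C by auto
        then show "x \<in> K" "K \<subseteq> {a..b}" "\<exists>u v. K = cbox u v"
          using i h_in[of i] by (auto simp: V_def seg_def box_real)
      next
        fix x1 K1 x2 K2
        assume "(x1, K1) \<in> h ` I \<and> (x2, K2) \<in> h ` I \<and> (x1, K1) \<noteq> (x2, K2)"
        then obtain i j where ij: "i \<in> I" "j \<in> I" "K1 = seg i" "K2 = seg j" "i \<noteq> j" by (auto simp: h_def)
        then have "disjnt (seg i) (seg j)" using C(3) that unfolding pairwise_def by blast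
        then show "interior K1 \<inter> interior K2 = {}"
          using ij interior_subset unfolding disjnt_def by blast
      qed
      have "seg i \<subseteq> \<gamma> (fst i)" if "i \<in> V" for i using that by (cases i) (simp add: V_def)
      then have fine: "\<gamma> fine (h ` I)" using that(1) C(2) by (auto simp: fine_def h_def)
      have "measure lebesgue (\<Union>i\<in>I. seg i) \<le> (\<Sum>i\<in>I. measure lebesgue (seg i))"
        using that by (intro measure_UNION_le) (auto simp: seg_def)
      also have "\<dots> \<le> (\<Sum>i\<in>I. R (fst i) (snd i) / c)"
      proof (rule sum_mono)
        fix i assume "i \<in> I"
        then have "i \<in> V" using that C by auto
        then show "measure lebesgue (seg i) \<le> R (fst i) (snd i) / c"
          using \<open>c > 0\<close> by (auto simp: V_def seg_def field_simps min_def max_def abs_if split: if_splits)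
      qed
      also have "\<dots> = (\<Sum>i\<in>I. norm (measure lborel (seg i) *\<^sub>R f (fst i) - integral (seg i) f)) / c"
        unfolding sum_divide_distrib
        by (intro sum.cong refl) (use R that C(2) in auto)
      also have "\<dots> = (\<Sum>(x, k)\<in>h ` I. norm (measure lborel k *\<^sub>R f x - integral k f)) / c"
        unfolding sum.reindex[OF inj] by (simp add: h_def)
      also have "\<dots> \<le> e * c / c"
        using \<gamma>[OF tag fine] \<open>c > 0\<close> by (intro divide_right_mono) auto
      finally show ?thesis using \<open>c > 0\<close> by simp
    qed
    have seg_meas: "seg i \<in> lmeasurable" for i by (cases i) (simp add: seg_def)
    have U: "(\<Union>i\<in>C. seg i) \<in> lmeasurable" "measure lebesgue (\<Union>i\<in>C. seg i) \<le> e"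
      using fmeasurable_UN_bound[OF C(1) seg_meas bound] measure_UN_bound[OF C(1) seg_meas bound]
      by blast+
    define X where "X = (\<Union>i\<in>C. seg i) \<union> (E c - (\<Union>i\<in>C. seg i))"
    have N: "E c - (\<Union>i\<in>C. seg i) \<in> lmeasurable" "measure lebesgue (E c - (\<Union>i\<in>C. seg i)) = 0"
      using negC unfolding negligible_iff_measure by auto
    have "X \<in> lmeasurable" unfolding X_def using U N by (intro fmeasurable.Un) auto
    moreover have "measure lebesgue X \<le> e"
      unfolding X_def using measure_Un_le[OF fmeasurableD[OF U(1)] fmeasurableD[OF N(1)]] N(2) U(2) by linarith
    moreover have "E c \<subseteq> X" by (auto simp: X_def)
    ultimately show "\<exists>T. E c \<subseteq> T \<and> T \<in> lmeasurable \<and> measure lebesgue T \<le> e" by blast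
  qed
  define N where "N = (\<Union>n. E (inverse (real (Suc n))))"
  have "negligible N" unfolding N_def by (intro negligible_Union_nat neg) auto
  moreover have "((\<lambda>x. integral {a..x} f) has_vector_derivative f t) (at t within {a..b})"
    if t: "t \<in> {a..b} - N" for t
    unfolding F_def[symmetric] has_vector_derivative_def has_derivative_within_alt
  proof (intro conjI allI impI)
    show "bounded_linear (\<lambda>x. x *\<^sub>R f t)" by (rule bounded_linear_scaleR_left)
    fix e :: real assume "e > 0"
    then obtain n where n: "inverse (real (Suc n)) < e" using reals_Archimedean by blast
    have "t \<notin> E (inverse (real (Suc n)))" using t by (auto simp: N_def)
    then have "\<not> (\<forall>d>0. \<exists>y\<in>{a..b}. \<bar>y - t\<bar> < d \<and> R t y > inverse (real (Suc n)) * \<bar>y - t\<bar>)"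
      using t by (simp add: E_def)
    then obtain d where "d > 0"
      and d: "\<And>y. y \<in> {a..b} \<Longrightarrow> \<bar>y - t\<bar> < d \<Longrightarrow> R t y \<le> inverse (real (Suc n)) * \<bar>y - t\<bar>"
      unfolding not_all not_imp not_less bex_simps Set.ball_simps not_le by (meson not_less)
    have "norm (F y - F t - (y - t) *\<^sub>R f t) \<le> e * norm (y - t)" if "y \<in> {a..b}" "norm (y - t) < d" for y
    proof -
      have "R t y \<le> inverse (real (Suc n)) * \<bar>y - t\<bar>" using d that by simp
      also have "\<dots> \<le> e * \<bar>y - t\<bar>" using n by (intro mult_right_mono) auto
      finally show ?thesis by (simp add: R_def)
    qed
    then show "\<exists>d>0. \<forall>y\<in>{a..b}. norm (y - t) < d \<longrightarrow> norm (F y - F t - (y - t) *\<^sub>R f t) \<le> e * norm (y - t)"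
      using \<open>d > 0\<close> by blast
  qed
  ultimately show thesis by (rule that)
qed

section \<open>Curves as primitives of their velocities\<close>

lemma AE_lebesgue_on_iff_negligible:
  "(AE t in lebesgue_on {a..b::real}. P t) \<longleftrightarrow> (\<exists>N. negligible N \<and> (\<forall>t\<in>{a..b} - N. P t))"
proof -
  have "(AE t in lebesgue_on {a..b}. P t) \<longleftrightarrow> (AE t in lebesgue. t \<in> {a..b} \<longrightarrow> P t)"
    by (rule AE_restrict_space_iff) simp
  also have "\<dots> \<longleftrightarrow> (\<exists>N. negligible N \<and> (\<forall>t\<in>{a..b} - N. P t))"
  proof
    assume "AE t in lebesgue. t \<in> {a..b} \<longrightarrow> P t"
    then obtain N where "N \<in> null_sets lebesgue" "{t \<in> space lebesgue. \<not> (t \<in> {a..b} \<longrightarrow> P t)} \<subseteq> N"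
      unfolding eventually_ae_filter by auto
    then show "\<exists>N. negligible N \<and> (\<forall>t\<in>{a..b} - N. P t)"
      by (intro exI[of _ N]) (auto simp: negligible_iff_null_sets)
  next
    assume "\<exists>N. negligible N \<and> (\<forall>t\<in>{a..b} - N. P t)"
    then obtain N where "negligible N" "\<forall>t\<in>{a..b} - N. P t" by auto
    then show "AE t in lebesgue. t \<in> {a..b} \<longrightarrow> P t"
      by (intro AE_I'[of N]) (auto simp: negligible_iff_null_sets)
  qed
  finally show ?thesis .
qed

text \<open>The integral form of an almost-everywhere equation. It passes to pointwise limits by dominated
  convergence, whereas the almost-everywhere derivatives of converging curves give no direct access to
  the derivative of the limit.\<close>

definition primitive_on :: "real \<Rightarrow> (real \<Rightarrow> 'a::euclidean_space) \<Rightarrow> (real \<Rightarrow> 'a) \<Rightarrow> bool" where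
  "primitive_on T g x \<longleftrightarrow> (\<forall>a b. 0 \<le> a \<and> a \<le> b \<and> b \<le> T \<longrightarrow> (g has_integral x b - x a) {a..b})"

lemma primitive_onD:
  "primitive_on T g x \<Longrightarrow> 0 \<le> a \<Longrightarrow> a \<le> b \<Longrightarrow> b \<le> T \<Longrightarrow> (g has_integral x b - x a) {a..b}"
  unfolding primitive_on_def by blast

lemma primitive_on_diff:
  assumes "primitive_on T g x" "primitive_on T h y"
  shows "primitive_on T (\<lambda>t. g t - h t) (\<lambda>t. x t - y t)"
  unfolding primitive_on_def
proof (intro allI impI)
  fix a b assume "0 \<le> a \<and> a \<le> b \<and> b \<le> T"
  then have "((\<lambda>t. g t - h t) has_integral (x b - x a) - (y b - y a)) {a..b}"
    using assms by (intro has_integral_diff primitive_onD) auto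
  then show "((\<lambda>t. g t - h t) has_integral (x b - y b) - (x a - y a)) {a..b}"
    by (simp add: algebra_simps)
qed

lemma primitive_on_scaleR:
  assumes "primitive_on T g x"
  shows "primitive_on T (\<lambda>t. c *\<^sub>R g t) (\<lambda>t. c *\<^sub>R x t)"
  using assms unfolding primitive_on_def
  by (auto simp: scaleR_diff_right[symmetric] intro: has_integral_cmul)

lemma ae_ode_solution_imp_primitive_on:
  fixes x :: "real \<Rightarrow> 'a::euclidean_space"
  assumes "ae_ode_solution T F x"
  shows "primitive_on T (\<lambda>t. F t (x t)) x"
proof -
  obtain N where N: "negligible N"
    "\<And>t. t \<in> {0..T} - N \<Longrightarrow> (x has_vector_derivative F t (x t)) (at t within {0..T})"
    using assms unfolding ae_ode_solution_def AE_lebesgue_on_iff_negligible by blast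
  have ac: "abs_continuous_on_interval 0 T x" using assms by (simp add: ae_ode_solution_def)
  show ?thesis unfolding primitive_on_def
  proof (intro allI impI)
    fix a b assume "0 \<le> a \<and> a \<le> b \<and> b \<le> T"
    then show "((\<lambda>t. F t (x t)) has_integral x b - x a) {a..b}"
      by (intro abs_continuous_has_integral[OF ac _ _ _ N]) auto
  qed
qed

text \<open>A finite exceptional set is admitted since a curve may violate the velocity bound at the very time
  when it leaves the region where that bound is known.\<close>

lemma primitive_on_increment_le:
  assumes x: "primitive_on T g x" and st: "s \<in> {0..T}" "t \<in> {0..T}" and "finite X" "0 \<le> M"
    and M: "\<And>r. r \<in> closed_segment s t - X \<Longrightarrow> norm (g r) \<le> M"
  shows "norm (x t - x s) \<le> M * \<bar>t - s\<bar>"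
proof -
  have *: "norm (x b - x a) \<le> M * (b - a)"
    if "0 \<le> a" "a \<le> b" "b \<le> T" "\<And>r. r \<in> {a..b} - X \<Longrightarrow> norm (g r) \<le> M" for a b
  proof -
    define h where "h r = (if r \<in> X then 0 else g r)" for r
    have "(h has_integral x b - x a) {a..b}"
      using primitive_onD[OF x that(1-3)]
      by (rule has_integral_spike_finite[OF \<open>finite X\<close>, rotated]) (auto simp: h_def)
    then show ?thesis
      using has_integral_bound[of M h "x b - x a" a b] that \<open>0 \<le> M\<close> by (auto simp: h_def)
  qed
  show ?thesis
  proof (cases "s \<le> t")
    case True
    then show ?thesis using *[of s t] st M by (auto simp: closed_segment_eq_real_ivl)
  next
    case False
    then show ?thesis using *[of t s] st M by (auto simp: closed_segment_eq_real_ivl norm_minus_commute)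
  qed
qed

lemma primitive_on_continuous:
  assumes "primitive_on T g x"
  shows "continuous_on {0..T} x"
proof (cases "0 \<le> T")
  case True
  have "g integrable_on {0..T}" using primitive_onD[OF assms, of 0 T] True by auto
  then have "continuous_on {0..T} (\<lambda>t. x 0 + integral {0..t} g)"
    by (intro continuous_intros indefinite_integral_continuous_1)
  moreover have "x 0 + integral {0..t} g = x t" if "t \<in> {0..T}" for t
    using integral_unique[OF primitive_onD[OF assms, of 0 t]] that by simp
  ultimately show ?thesis by (rule continuous_on_eq)
qed simp

text \<open>Before the curve leaves the ball its speed is at most \<open>M\<close>, so until time \<open>t\<close> it moves by at most
  \<open>M * \<bar>t - s\<bar>\<close>, which does not suffice to reach the boundary.\<close>

lemma primitive_on_trapped:
  assumes x: "primitive_on T g x" and st: "s \<in> {0..T}" "t \<in> {0..T}" and "0 \<le> M"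
    and M: "\<And>r. r \<in> {0..T} \<Longrightarrow> x r \<in> cball c R \<Longrightarrow> norm (g r) \<le> M"
    and near: "norm (x s - c) + M * \<bar>t - s\<bar> < R"
  shows "x t \<in> cball c R"
proof (rule ccontr)
  assume "x t \<notin> cball c R"
  define A where "A = {r \<in> closed_segment s t. R \<le> norm (x r - c)}"
  have sub: "closed_segment s t \<subseteq> {0..T}" using st by (auto simp: closed_segment_eq_real_ivl split: if_splits)
  have "closed A" unfolding A_def
    by (intro continuous_on_closed_Collect_le continuous_intros closed_segment
        continuous_on_subset[OF primitive_on_continuous[OF x] sub])
  then have "compact A"
    using compact_Int_closed[OF compact_segment[of s t], of A] by (auto simp: A_def Int_def)
  moreover have "t \<in> A" using \<open>x t \<notin> cball c R\<close> by (auto simp: A_def dist_norm norm_minus_commute)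
  \<comment> \<open>The time in \<open>A\<close> closest to \<open>s\<close> is the first exit time; considering the distance to \<open>s\<close> covers the
    forward and the backward direction of time at once.\<close>
  ultimately obtain r where r: "r \<in> A" and first: "\<And>q. q \<in> A \<Longrightarrow> \<bar>r - s\<bar> \<le> \<bar>q - s\<bar>"
    using continuous_attains_inf[of A "\<lambda>r. \<bar>r - s\<bar>"] by (force intro!: continuous_intros)
  have rs: "r \<in> closed_segment s t" using r by (auto simp: A_def)
  have "norm (x r - x s) \<le> M * \<bar>r - s\<bar>"
  proof (rule primitive_on_increment_le[OF x st(1), where X = "{r}"])
    show "r \<in> {0..T}" using rs sub by blast
    fix q assume q: "q \<in> closed_segment s r - {r}"
    then have "q \<in> closed_segment s t" "\<bar>q - s\<bar> < \<bar>r - s\<bar>"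
      using rs by (auto simp: closed_segment_eq_real_ivl split: if_splits)
    then have "q \<notin> A" using first[of q] by auto
    then show "norm (g q) \<le> M"
      using M[of q] sub \<open>q \<in> closed_segment s t\<close>
      by (auto simp: A_def dist_norm norm_minus_commute subset_iff)
  qed (use \<open>0 \<le> M\<close> in auto)
  moreover have "M * \<bar>r - s\<bar> \<le> M * \<bar>t - s\<bar>"
    using rs \<open>0 \<le> M\<close> by (intro mult_left_mono) (auto simp: closed_segment_eq_real_ivl split: if_splits)
  moreover have "norm (x r - c) \<le> norm (x r - x s) + norm (x s - c)"
    using norm_triangle_ineq[of "x r - x s" "x s - c"] by simp
  ultimately show False using r near by (simp add: A_def)
qed

text \<open>Convergence at single times improves to a bound for all times. Around each time \<open>s\<close> the curves
  remain in a ball about \<open>x0 s\<close> for a duration that is independent of the curve, and finitely many of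
  the resulting time intervals cover \<open>{0..T}\<close>.\<close>

lemma primitive_on_family_bounded:
  fixes x g :: "'i \<Rightarrow> real \<Rightarrow> 'a::euclidean_space"
  assumes "open S"
    and x: "\<forall>\<^sub>F i in F. primitive_on T (g i) (x i)"
    and lim: "\<And>t. t \<in> {0..T} \<Longrightarrow> ((\<lambda>i. x i t) \<longlongrightarrow> x0 t) F"
    and x0: "\<And>t. t \<in> {0..T} \<Longrightarrow> x0 t \<in> S"
    and bound: "\<And>K. compact K \<Longrightarrow> K \<subseteq> S \<Longrightarrow>
      \<exists>M. \<forall>\<^sub>F i in F. \<forall>t\<in>{0..T}. x i t \<in> K \<longrightarrow> norm (g i t) \<le> M"
  shows "\<exists>K M. compact K \<and> K \<subseteq> S \<and> (\<forall>\<^sub>F i in F. \<forall>t\<in>{0..T}. x i t \<in> K \<and> norm (g i t) \<le> M)"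
proof -
  define Q where "Q s d K \<longleftrightarrow> 0 < d \<and> compact K \<and> K \<subseteq> S \<and>
      (\<forall>\<^sub>F i in F. \<forall>t\<in>{0..T} \<inter> ball s d. x i t \<in> K)" for s :: real and d :: real and K
  have local: "\<exists>d K. Q s d K" if s: "s \<in> {0..T}" for s
  proof -
    obtain R where "R > 0" and R: "cball (x0 s) R \<subseteq> S"
      using \<open>open S\<close> x0[OF s] by (meson open_contains_cball)
    obtain M where M: "\<forall>\<^sub>F i in F. \<forall>t\<in>{0..T}. x i t \<in> cball (x0 s) R \<longrightarrow> norm (g i t) \<le> M"
      using bound[OF compact_cball R] by blast
    \<comment> \<open>In time \<open>d\<close> a curve of speed at most \<open>M\<close> moves by at most \<open>R / 2\<close>.\<close>
    define d where "d = R / (2 * (\<bar>M\<bar> + 1))"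
    have "d > 0" using \<open>R > 0\<close> by (simp add: d_def)
    have near: "\<forall>\<^sub>F i in F. norm (x i s - x0 s) < R / 2"
      using tendstoD[OF lim[OF s], of "R / 2"] \<open>R > 0\<close> by (simp add: dist_norm)
    have "\<forall>\<^sub>F i in F. \<forall>t\<in>{0..T} \<inter> ball s d. x i t \<in> cball (x0 s) R"
      using x M near
    proof eventually_elim
      case (elim i)
      show ?case
      proof
        fix t assume t: "t \<in> {0..T} \<inter> ball s d"
        have "\<bar>M\<bar> * \<bar>t - s\<bar> \<le> (\<bar>M\<bar> + 1) * d"
          using t by (intro mult_mono) (auto simp: dist_real_def)
        also have "\<dots> = R / 2" by (simp add: d_def field_simps)
        finally have "norm (x i s - x0 s) + \<bar>M\<bar> * \<bar>t - s\<bar> < R" using elim(3) by linarith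
        then show "x i t \<in> cball (x0 s) R"
          using t elim(2)
          by (intro primitive_on_trapped[OF elim(1) s, where M = "\<bar>M\<bar>"]) (auto intro: order_trans[OF _ abs_ge_self])
      qed
    qed
    then have "Q s d (cball (x0 s) R)" using \<open>d > 0\<close> R by (simp add: Q_def)
    then show ?thesis by (intro exI)
  qed
  then obtain d K where Q: "\<And>s. s \<in> {0..T} \<Longrightarrow> Q s (d s) (K s)"
    by metis
  then have d: "\<And>s. s \<in> {0..T} \<Longrightarrow> 0 < d s"
    and K: "\<And>s. s \<in> {0..T} \<Longrightarrow> compact (K s)" "\<And>s. s \<in> {0..T} \<Longrightarrow> K s \<subseteq> S"
      "\<And>s. s \<in> {0..T} \<Longrightarrow> \<forall>\<^sub>F i in F. \<forall>t\<in>{0..T} \<inter> ball s (d s). x i t \<in> K s"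
    unfolding Q_def by simp_all
  obtain I where I: "I \<subseteq> {0..T}" "finite I" "{0..T} \<subseteq> (\<Union>s\<in>I. ball s (d s))"
    using compactE_image[OF compact_Icc, of "{0..T}" "\<lambda>s. ball s (d s)" 0 T] d by force
  define L where "L = (\<Union>s\<in>I. K s)"
  have "compact L" unfolding L_def using I K(1) by (intro compact_UN) auto
  moreover have "L \<subseteq> S" unfolding L_def by (intro UN_least K(2) subsetD[OF I(1)])
  ultimately have L: "compact L" "L \<subseteq> S" .
  have "\<forall>\<^sub>F i in F. \<forall>s\<in>I. \<forall>t\<in>{0..T} \<inter> ball s (d s). x i t \<in> K s"
    using I K(3) by (intro eventually_ball_finite) auto
  then have in_L: "\<forall>\<^sub>F i in F. \<forall>t\<in>{0..T}. x i t \<in> L"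
  proof eventually_elim
    case (elim i)
    show ?case
    proof
      fix t assume t: "t \<in> {0..T}"
      then obtain s where s: "s \<in> I" "t \<in> ball s (d s)" using I(3) by blast
      then have "x i t \<in> K s" using elim t by (meson IntI)
      then show "x i t \<in> L" unfolding L_def using s(1) by (rule UN_I[rotated])
    qed
  qed
  obtain M where M: "\<forall>\<^sub>F i in F. \<forall>t\<in>{0..T}. x i t \<in> L \<longrightarrow> norm (g i t) \<le> M"
    using bound[OF L] by blast
  have "\<forall>\<^sub>F i in F. \<forall>t\<in>{0..T}. x i t \<in> L \<and> norm (g i t) \<le> M"
    using in_L M by eventually_elim auto
  with L show ?thesis by (intro exI[of _ L] exI[of _ M] conjI)
qed

text \<open>Dominated convergence along a sequence of parameters tending to \<open>0\<close>; the dominating function is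
  the constant \<open>M\<close>. Measurability of \<open>g0\<close> comes out of the limit as well.\<close>

lemma primitive_on_limit:
  fixes x g :: "real \<Rightarrow> real \<Rightarrow> 'a::euclidean_space"
  assumes x: "\<forall>\<^sub>F \<epsilon> in at_right 0. primitive_on T (g \<epsilon>) (x \<epsilon>)"
    and M: "\<forall>\<^sub>F \<epsilon> in at_right 0. \<forall>t\<in>{0..T}. norm (g \<epsilon> t) \<le> M"
    and x0: "\<And>t. t \<in> {0..T} \<Longrightarrow> ((\<lambda>\<epsilon>. x \<epsilon> t) \<longlongrightarrow> x0 t) (at_right 0)"
    and g0: "\<And>t. t \<in> {0..T} \<Longrightarrow> ((\<lambda>\<epsilon>. g \<epsilon> t) \<longlongrightarrow> g0 t) (at_right 0)"
  shows "primitive_on T g0 x0" and "\<And>t. t \<in> {0..T} \<Longrightarrow> norm (g0 t) \<le> M"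
proof -
  show "norm (g0 t) \<le> M" if "t \<in> {0..T}" for t
  proof (rule tendsto_upperbound[OF tendsto_norm[OF g0[OF that]]])
    show "\<forall>\<^sub>F \<epsilon> in at_right 0. norm (g \<epsilon> t) \<le> M"
      using M by eventually_elim (use that in auto)
  qed simp
  have seq: "filterlim (\<lambda>n. inverse (real (Suc n))) (at_right 0) sequentially"
    by (intro filterlim_at_withinI LIMSEQ_inverse_real_of_nat) simp
  define P where "P \<epsilon> \<longleftrightarrow> primitive_on T (g \<epsilon>) (x \<epsilon>) \<and> (\<forall>t\<in>{0..T}. norm (g \<epsilon> t) \<le> M)" for \<epsilon>
  have "\<forall>\<^sub>F \<epsilon> in at_right 0. P \<epsilon>" unfolding P_def using x M by (rule eventually_conj)
  then have "\<forall>\<^sub>F n in sequentially. P (inverse (real (Suc n)))"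
    using seq by (rule eventually_compose_filterlim)
  then obtain n0 where n0: "\<And>n. n \<ge> n0 \<Longrightarrow> P (inverse (real (Suc n)))"
    unfolding eventually_sequentially by blast
  \<comment> \<open>The shift by \<open>n0\<close> turns the eventual properties into properties of every member of the sequence.\<close>
  define e where "e n = inverse (real (Suc (n + n0)))" for n
  have P: "P (e n)" for n unfolding e_def by (rule n0) simp
  have e: "filterlim e (at_right 0) sequentially"
    unfolding e_def by (rule filterlim_compose[OF seq filterlim_add_const_nat_at_top])
  show "primitive_on T g0 x0" unfolding primitive_on_def
  proof (intro allI impI)
    fix a b assume ab: "0 \<le> a \<and> a \<le> b \<and> b \<le> T"
    have int: "(g (e n) has_integral x (e n) b - x (e n) a) {a..b}" for n
      using P[of n] ab unfolding P_def by (blast intro: primitive_onD)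
    have int': "g (e n) integrable_on {a..b}" for n using int by (rule has_integral_integrable)
    have le: "norm (g (e n) t) \<le> M" if "t \<in> {a..b}" for n t
      using P[of n] that ab by (simp add: P_def)
    have conv: "(\<lambda>n. g (e n) t) \<longlonglongrightarrow> g0 t" if "t \<in> {a..b}" for t
      using filterlim_compose[OF g0 e, of t] that ab by simp
    have "g0 integrable_on {a..b}" "(\<lambda>n. integral {a..b} (g (e n))) \<longlonglongrightarrow> integral {a..b} g0"
      using dominated_convergence[OF int' integrable_const_ivl le conv] by blast+
    moreover have "(\<lambda>n. integral {a..b} (g (e n))) \<longlonglongrightarrow> x0 b - x0 a"
      unfolding integral_unique[OF int]
      using filterlim_compose[OF x0 e, of a] filterlim_compose[OF x0 e, of b] ab
      by (intro tendsto_diff) auto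
    ultimately have "g0 integrable_on {a..b}" "integral {a..b} g0 = x0 b - x0 a"
      using LIMSEQ_unique by blast+
    then show "(g0 has_integral x0 b - x0 a) {a..b}"
      by (simp add: has_integral_integrable_integral)
  qed
qed

lemma primitive_on_has_vector_derivative:
  assumes x: "primitive_on T g x" and g: "continuous_on {0..T} g" and t: "t \<in> {0..T}"
  shows "(x has_vector_derivative g t) (at t within {0..T})"
proof -
  have "((\<lambda>r. x 0 + integral {0..r} g) has_vector_derivative g t) (at t within {0..T})"
    using integral_has_vector_derivative[OF g t] by (auto intro!: derivative_eq_intros)
  moreover have "x 0 + integral {0..r} g = x r" if "r \<in> {0..T}" for r
    using integral_unique[OF primitive_onD[OF x, of 0 r]] that by simp
  ultimately show ?thesis
    by (intro has_vector_derivative_transform[OF t, of x "\<lambda>r. x 0 + integral {0..r} g"]) simp_all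
qed

lemma lipschitz_imp_abs_continuous:
  fixes x :: "real \<Rightarrow> 'a::real_normed_vector"
  assumes lip: "\<And>s t. s \<in> {a..b} \<Longrightarrow> t \<in> {a..b} \<Longrightarrow> norm (x t - x s) \<le> M * \<bar>t - s\<bar>"
  shows "abs_continuous_on_interval a b x"
  unfolding abs_continuous_on_interval_def
proof (intro allI impI)
  fix e :: real assume "e > 0"
  define d where "d = e / (\<bar>M\<bar> + 1)"
  have "d > 0" using \<open>e > 0\<close> by (simp add: d_def)
  moreover have "(\<Sum>K\<in>D. norm (x (Sup K) - x (Inf K))) < e"
    if D: "D division_of S \<and> S \<subseteq> {a..b} \<and> (\<Sum>K\<in>D. Sup K - Inf K) < d" for D S
  proof -
    have "(\<Sum>K\<in>D. norm (x (Sup K) - x (Inf K))) \<le> (\<Sum>K\<in>D. \<bar>M\<bar> * (Sup K - Inf K))"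
    proof (rule sum_mono)
      fix K assume "K \<in> D"
      then obtain u v where K: "K = {u..v}" "u \<le> v" "{u..v} \<subseteq> {a..b}"
        using division_ofD(2,3,4)[of D S K] D
        by (metis atLeastatMost_empty_iff box_real(2) order_trans)
      have "norm (x v - x u) \<le> M * \<bar>v - u\<bar>" using K by (intro lip) auto
      also have "\<dots> \<le> \<bar>M\<bar> * (v - u)" using K by (auto intro: mult_right_mono)
      finally show "norm (x (Sup K) - x (Inf K)) \<le> \<bar>M\<bar> * (Sup K - Inf K)" using K by simp
    qed
    also have "\<dots> \<le> \<bar>M\<bar> * d"
      using D by (auto simp: sum_distrib_left[symmetric] intro: mult_left_mono)
    also have "\<dots> < e" using \<open>e > 0\<close> by (simp add: d_def field_simps)
    finally show ?thesis .
  qed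
  ultimately show "\<exists>d>0. \<forall>D S. D division_of S \<and> S \<subseteq> {a..b} \<and> (\<Sum>K\<in>D. Sup K - Inf K) < d \<longrightarrow>
      (\<Sum>K\<in>D. norm (x (Sup K) - x (Inf K))) < e" by blast
qed

text \<open>A bounded velocity makes the curve Lipschitz, hence absolutely continuous; the derivative is the
  almost-everywhere derivative of an indefinite integral.\<close>

lemma primitive_on_imp_ae_ode_solution:
  assumes "0 \<le> T" and x: "primitive_on T g x" and M: "\<And>t. t \<in> {0..T} \<Longrightarrow> norm (g t) \<le> M"
    and F: "\<And>t. t \<in> {0..T} \<Longrightarrow> F t (x t) = g t"
  shows "ae_ode_solution T F x"
  unfolding ae_ode_solution_def AE_lebesgue_on_iff_negligible
proof
  show "abs_continuous_on_interval 0 T x"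
  proof (rule lipschitz_imp_abs_continuous)
    fix s t assume st: "s \<in> {0..T}" "t \<in> {0..T}"
    then have "closed_segment s t \<subseteq> {0..T}" by (auto simp: closed_segment_eq_real_ivl split: if_splits)
    then show "norm (x t - x s) \<le> \<bar>M\<bar> * \<bar>t - s\<bar>"
      using order_trans[OF M abs_ge_self] by (intro primitive_on_increment_le[OF x st, of "{}"]) auto
  qed
  have "g integrable_on {0..T}" using primitive_onD[OF x, of 0 T] \<open>0 \<le> T\<close> by auto
  then obtain N where N: "negligible N"
    "\<And>t. t \<in> {0..T} - N \<Longrightarrow> ((\<lambda>r. integral {0..r} g) has_vector_derivative g t) (at t within {0..T})"
    by (rule indefinite_integral_ae_has_vector_derivative) (rule that)
  have eq: "x 0 + integral {0..r} g = x r" if "r \<in> {0..T}" for r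
    using integral_unique[OF primitive_onD[OF x, of 0 r]] that by simp
  have "(x has_vector_derivative F t (x t)) (at t within {0..T})" if t: "t \<in> {0..T} - N" for t
  proof -
    have "((\<lambda>r. x 0 + integral {0..r} g) has_vector_derivative g t) (at t within {0..T})"
      using N(2)[OF t] by (auto intro!: derivative_eq_intros)
    then have "(x has_vector_derivative g t) (at t within {0..T})"
      using t eq by (intro has_vector_derivative_transform[of t "{0..T}" x]) auto
    then show ?thesis using t F by simp
  qed
  then show "\<exists>N. negligible N \<and> (\<forall>t\<in>{0..T} - N. (x has_vector_derivative F t (x t)) (at t within {0..T}))"
    using N(1) by (intro exI[of _ N]) simp
qed

section \<open>Gradients, Hessians and local Lipschitz bounds\<close>

text \<open>The norm of a matrix is the Euclidean norm of its entries, so this is the Cauchy-Schwarz inequality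
  applied to each row.\<close>

lemma norm_matrix_vector_le:
  fixes A :: "real^'n^'m"
  shows "norm (A *v x) \<le> norm A * norm x"
proof -
  have "norm (A *v x) \<le> L2_set (\<lambda>i. norm x * norm (A $ i)) UNIV"
    unfolding norm_vec_def[of "A *v x"]
    by (rule L2_set_mono) (auto simp: matrix_mult_dot mult.commute[of "norm x"] intro: Cauchy_Schwarz_ineq2)
  also have "\<dots> = norm A * norm x"
    by (simp add: L2_set_right_distrib[symmetric] norm_vec_def[of A] mult.commute)
  finally show ?thesis .
qed

lemma bounded_bilinear_matrix_vector: "bounded_bilinear (\<lambda>(A::real^'n^'m) x. A *v x)"
proof
  show "\<exists>K. \<forall>(A::real^'n^'m) x. norm (A *v x) \<le> norm A * norm x * K"
    by (intro exI[of _ 1]) (simp add: norm_matrix_vector_le)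
qed (simp_all add: matrix_vector_mult_add_rdistrib matrix_vector_right_distrib
  matrix_vector_mult_scaleR scaleR_matrix_vector_assoc)

lemmas continuous_on_matrix_vector = bounded_bilinear.continuous_on[OF bounded_bilinear_matrix_vector]
lemmas tendsto_matrix_vector = bounded_bilinear.tendsto[OF bounded_bilinear_matrix_vector]

lemma compact_continuous_image_bounded:
  assumes "compact K" "continuous_on K f"
  shows "\<exists>B\<ge>0. \<forall>x\<in>K. norm (f x) \<le> B"
proof -
  have "bounded (f ` K)" using assms by (intro compact_imp_bounded compact_continuous_image)
  then obtain B where "0 < B" "\<And>y. y \<in> f ` K \<Longrightarrow> norm y \<le> B" unfolding bounded_pos by auto
  then show ?thesis by (intro exI[of _ B]) auto
qed

lemma has_derivative_grad:
  assumes "f differentiable (at x)"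
  shows "(f has_derivative (\<lambda>h. grad f x \<bullet> h)) (at x)"
proof -
  have f: "(f has_derivative frechet_derivative f (at x)) (at x)"
    using assms by (simp add: frechet_derivative_works)
  have lin: "linear (frechet_derivative f (at x))" using has_derivative_linear[OF f] .
  have "frechet_derivative f (at x) h = grad f x \<bullet> h" for h
  proof -
    have "frechet_derivative f (at x) h = frechet_derivative f (at x) (\<Sum>i\<in>UNIV. (h $ i) *\<^sub>R axis i 1)"
      using basis_expansion[of h] by (simp add: scalar_mult_eq_scaleR)
    also have "\<dots> = (\<Sum>i\<in>UNIV. h $ i * frechet_derivative f (at x) (axis i 1))"
      by (simp add: linear_sum[OF lin] linear_scale[OF lin])
    also have "\<dots> = grad f x \<bullet> h" by (simp add: grad_def inner_vec_def mult.commute)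
    finally show ?thesis .
  qed
  then have "frechet_derivative f (at x) = (\<lambda>h. grad f x \<bullet> h)" by (rule ext)
  then show ?thesis using f by simp
qed

lemma C2_on_differentiable:
  assumes "C2_on S f" "x \<in> S"
  shows "(f has_derivative (\<lambda>h. grad f x \<bullet> h)) (at x)"
    and "(grad f has_derivative (\<lambda>h. hessian f x *v h)) (at x)"
  using assms by (auto simp: C2_on_def hessian_def jacobian_works[symmetric] intro: has_derivative_grad)

lemma C2_on_continuous:
  assumes "C2_on S f"
  shows "continuous_on S (grad f)" "continuous_on S (hessian f)"
  using assms unfolding C2_on_def
  by (auto intro!: differentiable_imp_continuous_on simp: differentiable_on_def differentiable_at_withinI)

text \<open>Componentwise the chain rule for squares: row \<open>i\<close> of the Jacobian is \<open>2 * grad f x $ i\<close> times row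
  \<open>i\<close> of the Hessian.\<close>

lemma sq_grad_has_derivative:
  assumes "C2_on S f" "x \<in> S"
  shows "(sq_grad f has_derivative (\<lambda>h. (\<chi> i j. 2 * grad f x $ i * hessian f x $ i $ j) *v h)) (at x)"
proof (subst has_derivative_componentwise_within, intro ballI)
  fix b :: "real^'a" assume "b \<in> Basis"
  then obtain i where b: "b = axis i 1" by (auto simp: Basis_vec_def)
  have "((\<lambda>y. grad f y $ i) has_derivative (\<lambda>h. (hessian f x *v h) $ i)) (at x)"
    using bounded_linear.has_derivative[OF bounded_linear_vec_nth C2_on_differentiable(2)[OF assms]] .
  then have "((\<lambda>y. (grad f y $ i)\<^sup>2) has_derivative (\<lambda>h. 2 * grad f x $ i * (hessian f x *v h) $ i)) (at x)"
    by (auto intro!: derivative_eq_intros)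
  then show "((\<lambda>y. sq_grad f y \<bullet> b) has_derivative
      (\<lambda>h. ((\<chi> i j. 2 * grad f x $ i * hessian f x $ i $ j) *v h) \<bullet> b)) (at x)"
    by (simp add: b sq_grad_def cart_eq_inner_axis[symmetric] matrix_vector_mult_def sum_distrib_left mult.assoc)
qed

lemma jacobian_sq_grad:
  assumes "C2_on S f" "x \<in> S"
  shows "jacobian (sq_grad f) (at x) = (\<chi> i j. 2 * grad f x $ i * hessian f x $ i $ j)"
  unfolding jacobian_def frechet_derivative_at[OF sq_grad_has_derivative[OF assms], symmetric]
  by (rule matrix_of_matrix_vector_mul)

lemma sq_grad_continuous:
  assumes "C2_on S f"
  shows "continuous_on S (sq_grad f)" "continuous_on S (\<lambda>x. transpose (jacobian (sq_grad f) (at x)))"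
proof -
  note [continuous_intros] = C2_on_continuous[OF assms]
  show "continuous_on S (sq_grad f)"
    unfolding sq_grad_def[abs_def] by (intro continuous_intros)
  have "continuous_on S (\<lambda>x. \<chi> j i. 2 * grad f x $ i * hessian f x $ i $ j)"
    by (intro continuous_intros)
  then show "continuous_on S (\<lambda>x. transpose (jacobian (sq_grad f) (at x)))"
    by (rule continuous_on_eq) (simp add: jacobian_sq_grad[OF assms] transpose_def)
qed

text \<open>The closed tube of small radius around \<open>K\<close> is a compact subset of \<open>S\<close>, so the derivative is bounded
  on it, and the mean value inequality applies in each of its balls, which are convex. The Lipschitz
  constant is uniform over \<open>K\<close> but refers only to pairs of points in a common ball.\<close>

lemma C1_lipschitz_near_compact:
  fixes F :: "real^'n \<Rightarrow> real^'m"
  assumes S: "open S" and K: "compact K" "K \<subseteq> S"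
    and F: "\<And>x. x \<in> S \<Longrightarrow> (F has_derivative (\<lambda>h. A x *v h)) (at x)" and A: "continuous_on S A"
  shows "\<exists>r>0. \<exists>L\<ge>0. \<forall>x\<in>K. \<forall>y\<in>cball x r. \<forall>z\<in>cball x r. norm (F y - F z) \<le> L * norm (y - z)"
proof -
  obtain r where "r > 0" and r: "(\<Union>x\<in>K. cball x r) \<subseteq> S"
    using compact_subset_open_imp_cball_epsilon_subset[OF K(1) S K(2)] by blast
  define W where "W = (\<Union>x\<in>K. cball x r)"
  have tube: "W = {x + y |x y. x \<in> K \<and> y \<in> cball 0 r}"
  proof (intro equalityI subsetI)
    fix z assume "z \<in> W"
    then obtain x where "x \<in> K" "z \<in> cball x r" unfolding W_def by blast
    then show "z \<in> {x + y |x y. x \<in> K \<and> y \<in> cball 0 r}"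
      by (intro CollectI exI[of _ x] exI[of _ "z - x"]) (auto simp: dist_norm norm_minus_commute)
  next
    fix z assume "z \<in> {x + y |x y. x \<in> K \<and> y \<in> cball 0 r}"
    then obtain x y where "x \<in> K" "norm y \<le> r" "z = x + y" by auto
    then show "z \<in> W" unfolding W_def by (intro UN_I[of x]) (simp_all add: dist_norm)
  qed
  have "compact W"
    unfolding tube by (intro compact_sums K compact_cball)
  have "W \<subseteq> S" using r by (simp add: W_def)
  with \<open>compact W\<close> have "\<exists>L\<ge>0. \<forall>y\<in>W. norm (A y) \<le> L"
    by (intro compact_continuous_image_bounded continuous_on_subset[OF A])
  then obtain L where "0 \<le> L" and L: "\<forall>y\<in>W. norm (A y) \<le> L"
    by (elim exE conjE)
  have "\<forall>x\<in>K. \<forall>y\<in>cball x r. \<forall>z\<in>cball x r. norm (F y - F z) \<le> L * norm (y - z)"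
  proof (intro ballI)
    fix x y z assume x: "x \<in> K" and yz: "y \<in> cball x r" "z \<in> cball x r"
    show "norm (F y - F z) \<le> L * norm (y - z)"
    proof (rule differentiable_bound[OF convex_cball[of x r] _ _ yz])
      fix w assume w: "w \<in> cball x r"
      have "w \<in> W" unfolding W_def using x w by (rule UN_I)
      then have "w \<in> S" using \<open>W \<subseteq> S\<close> by (rule rev_subsetD)
      then show "(F has_derivative (\<lambda>h. A w *v h)) (at w within cball x r)"
        by (rule has_derivative_at_withinI[OF F])
      have "norm (A w) \<le> L" using L \<open>w \<in> W\<close> by (rule bspec)
      then show "onorm (\<lambda>h. A w *v h) \<le> L"
        by (intro onorm_le order_trans[OF norm_matrix_vector_le] mult_right_mono) auto
    qed
  qed
  with \<open>0 \<le> L\<close> have "\<exists>L\<ge>0. \<forall>x\<in>K. \<forall>y\<in>cball x r. \<forall>z\<in>cball x r. norm (F y - F z) \<le> L * norm (y - z)"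
    by (intro exI[of _ L] conjI)
  with \<open>r > 0\<close> show ?thesis by auto
qed

section \<open>Uniqueness for differential equations\<close>

text \<open>The set of times at which the curves agree is closed. It is also open: near such a time the largest
  distance of the curves on a short interval is at most half of itself by the Lipschitz bound, hence
  zero. Connectedness of the time interval concludes.\<close>

lemma ae_ode_unique:
  fixes x y :: "real \<Rightarrow> 'a::euclidean_space"
  assumes x: "primitive_on T (\<lambda>t. F t (x t)) x" and y: "primitive_on T (\<lambda>t. F t (y t)) y"
    and init: "x 0 = y 0" and S: "\<And>t. t \<in> {0..T} \<Longrightarrow> x t \<in> S"
    and lip: "\<And>z. z \<in> S \<Longrightarrow> \<exists>r>0. \<exists>L\<ge>0. \<forall>t\<in>{0..T}. \<forall>a\<in>ball z r. \<forall>b\<in>ball z r.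
      norm (F t a - F t b) \<le> L * norm (a - b)"
    and t: "t \<in> {0..T}"
  shows "x t = y t"
proof -
  note cx = primitive_on_continuous[OF x] and cy = primitive_on_continuous[OF y]
  define A where "A = {t \<in> {0..T}. x t - y t = 0}"
  have clo: "closedin (top_of_set {0..T}) A"
    unfolding A_def by (intro continuous_closedin_preimage_constant continuous_intros cx cy)
  have ope: "openin (top_of_set {0..T}) A"
    unfolding openin_euclidean_subtopology_iff
  proof (intro conjI ballI)
    show "A \<subseteq> {0..T}" by (auto simp: A_def)
    fix s assume "s \<in> A"
    then have s: "s \<in> {0..T}" "y s = x s" by (auto simp: A_def)
    obtain r L where "r > 0" "L \<ge> 0" and L: "\<And>t a b. t \<in> {0..T} \<Longrightarrow> a \<in> ball (x s) r \<Longrightarrow> b \<in> ball (x s) r \<Longrightarrow>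
        norm (F t a - F t b) \<le> L * norm (a - b)"
      using lip[OF S[OF s(1)]] by blast
    obtain d1 where d1: "d1 > 0" "\<And>t. t \<in> {0..T} \<Longrightarrow> dist t s < d1 \<Longrightarrow> dist (x t) (x s) < r"
      using cx[unfolded continuous_on_iff] s(1) \<open>r > 0\<close> by blast
    obtain d2 where d2: "d2 > 0" "\<And>t. t \<in> {0..T} \<Longrightarrow> dist t s < d2 \<Longrightarrow> dist (y t) (y s) < r"
      using cy[unfolded continuous_on_iff] s(1) \<open>r > 0\<close> by blast
    \<comment> \<open>On intervals of this length the curves stay in the ball with Lipschitz constant \<open>L\<close>, and \<open>L\<close> times
      the length is at most \<open>1 / 2\<close>.\<close>
    define d where "d = min (min d1 d2) (1 / (2 * (L + 1)))"
    have "d > 0" using d1 d2 \<open>L \<ge> 0\<close> by (simp add: d_def)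
    moreover have "t \<in> A" if t: "t \<in> {0..T}" "dist t s < d" for t
    proof -
      have sub: "closed_segment s t \<subseteq> {0..T}" using s t by (auto simp: closed_segment_eq_real_ivl split: if_splits)
      have near: "dist q s < d" if "q \<in> closed_segment s t" for q
        using t(2) that by (auto simp: closed_segment_eq_real_ivl dist_real_def split: if_splits)
      have "continuous_on (closed_segment s t) (\<lambda>q. norm (x q - y q))"
        by (intro continuous_intros continuous_on_subset[OF cx sub] continuous_on_subset[OF cy sub])
      then obtain m where m: "m \<in> closed_segment s t"
        and max: "\<And>q. q \<in> closed_segment s t \<Longrightarrow> norm (x q - y q) \<le> norm (x m - y m)"
        using continuous_attains_sup[of "closed_segment s t" "\<lambda>q. norm (x q - y q)"] by auto
      have "norm ((x m - y m) - (x s - y s)) \<le> (L * norm (x m - y m)) * \<bar>m - s\<bar>"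
      proof (rule primitive_on_increment_le[OF primitive_on_diff[OF x y], where X = "{}"])
        show "s \<in> {0..T}" "m \<in> {0..T}" using s m sub by auto
        show "0 \<le> L * norm (x m - y m)" using \<open>L \<ge> 0\<close> by simp
        fix q assume "q \<in> closed_segment s m - {}"
        then have q: "q \<in> closed_segment s t" using m by (auto simp: closed_segment_eq_real_ivl split: if_splits)
        then have "x q \<in> ball (x s) r" "y q \<in> ball (x s) r" "q \<in> {0..T}"
          using d1(2)[of q] d2(2)[of q] near[OF q] sub s(2) by (auto simp: d_def dist_commute)
        then have "norm (F q (x q) - F q (y q)) \<le> L * norm (x q - y q)" by (intro L)
        also have "\<dots> \<le> L * norm (x m - y m)" using max[OF q] \<open>L \<ge> 0\<close> by (intro mult_left_mono)
        finally show "norm (F q (x q) - F q (y q)) \<le> L * norm (x m - y m)" .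
      qed simp
      also have "\<dots> = (L * \<bar>m - s\<bar>) * norm (x m - y m)" by simp
      also have "\<dots> \<le> (1 / 2) * norm (x m - y m)"
      proof (rule mult_right_mono)
        have "L * \<bar>m - s\<bar> \<le> L * (1 / (2 * (L + 1)))"
          using near[OF m] \<open>L \<ge> 0\<close> by (intro mult_left_mono) (auto simp: d_def dist_real_def)
        also have "\<dots> \<le> 1 / 2" using \<open>L \<ge> 0\<close> by (simp add: field_simps)
        finally show "L * \<bar>m - s\<bar> \<le> 1 / 2" .
      qed simp
      finally have "norm (x m - y m) = 0" using s(2) by simp
      then show ?thesis using max[of t] t(1) by (simp add: A_def)
    qed
    ultimately show "\<exists>e>0. \<forall>t\<in>{0..T}. dist t s < e \<longrightarrow> t \<in> A" by blast
  qed
  have "0 \<in> A" using t init by (auto simp: A_def)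
  moreover have "A = {} \<or> A = {0..T}"
    by (rule connected_clopen[THEN iffD1, OF connected_Icc, rule_format, OF conjI[OF ope clo]])
  ultimately have "A = {0..T}" by auto
  with t have "t \<in> A" by simp
  then show ?thesis by (simp add: A_def)
qed

section \<open>First-order expansions\<close>

lemma first_order_expansionE:
  assumes "first_order_expansion f f0 f1"
  obtains C where "0 \<le> C" "\<forall>\<^sub>F \<epsilon> in at_right 0. norm (f \<epsilon> - (f0 + \<epsilon> *\<^sub>R f1)) \<le> C * \<epsilon>\<^sup>2"
proof -
  obtain C where "C > 0"
    and "\<forall>\<^sub>F \<epsilon> in at_right 0. norm (norm (f \<epsilon> - (f0 + \<epsilon> *\<^sub>R f1))) \<le> C * norm (\<epsilon>\<^sup>2)"
    using assms unfolding first_order_expansion_def by (elim landau_o.bigE)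
  then show thesis using that[of C] by simp
qed

lemma first_order_expansion_quotient:
  assumes "first_order_expansion f f0 f1"
  shows "((\<lambda>\<epsilon>. (1 / \<epsilon>) *\<^sub>R (f \<epsilon> - f0)) \<longlongrightarrow> f1) (at_right 0)"
proof -
  obtain C where C: "0 \<le> C" "\<forall>\<^sub>F \<epsilon> in at_right 0. norm (f \<epsilon> - (f0 + \<epsilon> *\<^sub>R f1)) \<le> C * \<epsilon>\<^sup>2"
    using assms by (rule first_order_expansionE)
  have "\<forall>\<^sub>F \<epsilon> in at_right 0. norm ((1 / \<epsilon>) *\<^sub>R (f \<epsilon> - f0) - f1) \<le> C * \<epsilon>"
    using C(2) eventually_at_right_less[of 0]
  proof eventually_elim
    case (elim \<epsilon>)
    have "(1 / \<epsilon>) *\<^sub>R (f \<epsilon> - f0) - f1 = (1 / \<epsilon>) *\<^sub>R (f \<epsilon> - (f0 + \<epsilon> *\<^sub>R f1))"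
      using elim by (simp add: algebra_simps)
    then have "norm ((1 / \<epsilon>) *\<^sub>R (f \<epsilon> - f0) - f1) = norm (f \<epsilon> - (f0 + \<epsilon> *\<^sub>R f1)) / \<epsilon>"
      using elim by simp
    also have "\<dots> \<le> C * \<epsilon>\<^sup>2 / \<epsilon>" using elim by (intro divide_right_mono) auto
    also have "\<dots> = C * \<epsilon>" using elim by (simp add: power2_eq_square)
    finally show ?case .
  qed
  moreover have "((\<lambda>\<epsilon>. C * \<epsilon>) \<longlongrightarrow> 0) (at_right 0)" by (auto intro!: tendsto_eq_intros)
  ultimately have "((\<lambda>\<epsilon>. (1 / \<epsilon>) *\<^sub>R (f \<epsilon> - f0) - f1) \<longlongrightarrow> 0) (at_right 0)"
    by (rule Lim_null_comparison)
  then show ?thesis by (simp add: LIM_zero_iff)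
qed

lemma tendsto_from_quotient:
  fixes f :: "real \<Rightarrow> 'a::real_normed_vector"
  assumes "((\<lambda>\<epsilon>. (1 / \<epsilon>) *\<^sub>R (f \<epsilon> - f0)) \<longlongrightarrow> f1) (at_right 0)"
  shows "(f \<longlongrightarrow> f0) (at_right 0)"
proof -
  have "((\<lambda>\<epsilon>. f0 + \<epsilon> *\<^sub>R ((1 / \<epsilon>) *\<^sub>R (f \<epsilon> - f0))) \<longlongrightarrow> f0 + 0 *\<^sub>R f1) (at_right 0)"
    by (intro tendsto_intros assms)
  moreover have "\<forall>\<^sub>F \<epsilon> in at_right 0. f0 + \<epsilon> *\<^sub>R ((1 / \<epsilon>) *\<^sub>R (f \<epsilon> - f0)) = f \<epsilon>"
    using eventually_at_right_less[of 0] by eventually_elim simp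
  ultimately show ?thesis by (simp add: tendsto_cong)
qed

lemma first_order_expansion_tendsto:
  "first_order_expansion f f0 f1 \<Longrightarrow> (f \<longlongrightarrow> f0) (at_right 0)"
  by (rule tendsto_from_quotient[OF first_order_expansion_quotient])

text \<open>The chain rule for a curve \<open>w\<close> that leaves \<open>x\<close> with the one-sided derivative \<open>v\<close>. The
  relative remainder \<open>\<rho>\<close> is continuous at \<open>x\<close> when it is given the value \<open>0\<close> there, which is exactly
  what \<open>0 / 0 = 0\<close> does; so the limit argument covers the parameters with \<open>w \<epsilon> = x\<close> too.\<close>

lemma has_derivative_quotient_tendsto:
  fixes F :: "'a::real_normed_vector \<Rightarrow> 'b::real_normed_vector"
  assumes F: "(F has_derivative F') (at x)"
    and w: "((\<lambda>\<epsilon>. (1 / \<epsilon>) *\<^sub>R (w \<epsilon> - x)) \<longlongrightarrow> v) (at_right 0)"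
  shows "((\<lambda>\<epsilon>. (1 / \<epsilon>) *\<^sub>R (F (w \<epsilon>) - F x)) \<longlongrightarrow> F' v) (at_right 0)"
proof -
  have lin: "bounded_linear F'" using F by (rule has_derivative_bounded_linear)
  define \<rho> where "\<rho> y = norm (F y - F x - F' (y - x)) / norm (y - x)" for y
  have "(\<rho> \<longlongrightarrow> \<rho> x) (at x)"
    using F unfolding has_derivative_iff_norm \<rho>_def by simp
  then have "isCont \<rho> x" by (simp add: isCont_def)
  then have "((\<lambda>\<epsilon>. \<rho> (w \<epsilon>)) \<longlongrightarrow> \<rho> x) (at_right 0)"
    using tendsto_from_quotient[OF w] by (rule isCont_tendsto_compose)
  then have "((\<lambda>\<epsilon>. \<rho> (w \<epsilon>) * norm ((1 / \<epsilon>) *\<^sub>R (w \<epsilon> - x))) \<longlongrightarrow> 0 * norm v) (at_right 0)"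
    by (intro tendsto_mult tendsto_norm w) (simp add: \<rho>_def)
  then have lim0: "((\<lambda>\<epsilon>. \<rho> (w \<epsilon>) * norm ((1 / \<epsilon>) *\<^sub>R (w \<epsilon> - x))) \<longlongrightarrow> 0) (at_right 0)" by simp
  have "\<forall>\<^sub>F \<epsilon> in at_right 0. norm ((1 / \<epsilon>) *\<^sub>R (F (w \<epsilon>) - F x) - F' ((1 / \<epsilon>) *\<^sub>R (w \<epsilon> - x)))
      \<le> \<rho> (w \<epsilon>) * norm ((1 / \<epsilon>) *\<^sub>R (w \<epsilon> - x))"
    using eventually_at_right_less[of 0]
  proof eventually_elim
    case (elim \<epsilon>)
    have "(1 / \<epsilon>) *\<^sub>R (F (w \<epsilon>) - F x) - F' ((1 / \<epsilon>) *\<^sub>R (w \<epsilon> - x))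
        = (1 / \<epsilon>) *\<^sub>R (F (w \<epsilon>) - F x - F' (w \<epsilon> - x))"
      by (simp only: linear_scale[OF bounded_linear.linear[OF lin]] scaleR_diff_right[symmetric])
    moreover have "norm (F (w \<epsilon>) - F x - F' (w \<epsilon> - x)) = \<rho> (w \<epsilon>) * norm (w \<epsilon> - x)"
      using linear_0[OF bounded_linear.linear[OF lin]] by (cases "w \<epsilon> = x") (auto simp: \<rho>_def)
    ultimately show ?case by simp
  qed
  then have "((\<lambda>\<epsilon>. (1 / \<epsilon>) *\<^sub>R (F (w \<epsilon>) - F x) - F' ((1 / \<epsilon>) *\<^sub>R (w \<epsilon> - x))) \<longlongrightarrow> 0) (at_right 0)"
    using lim0 by (rule Lim_null_comparison)
  from tendsto_add[OF this bounded_linear.tendsto[OF lin w]] show ?thesis by simp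
qed

text \<open>The gradient is Lipschitz near \<open>x\<close>, so the derivative of \<open>f y - grad f x \<bullet> y\<close> on the segment from
  \<open>x\<close> to \<open>z\<close> is at most of the order of its length; the mean value inequality gives the second factor.\<close>

lemma quadratic_taylor_bound:
  fixes f :: "real^'n \<Rightarrow> real"
  assumes S: "open S" "x \<in> S" and f: "C2_on S f"
  shows "\<exists>r>0. \<exists>C\<ge>0. \<forall>z\<in>cball x r. \<bar>f z - f x - grad f x \<bullet> (z - x)\<bar> \<le> C * (norm (z - x))\<^sup>2"
proof -
  obtain r0 where r0: "r0 > 0" "cball x r0 \<subseteq> S" using S by (meson open_contains_cball)
  have "{x} \<subseteq> S" using S(2) by simp
  from C1_lipschitz_near_compact[OF S(1) compact_sing this C2_on_differentiable(2)[OF f] C2_on_continuous(2)[OF f]]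
  obtain r1 L where "0 < r1" "0 \<le> L"
    and lip: "\<forall>y\<in>cball x r1. \<forall>z\<in>cball x r1. norm (grad f y - grad f z) \<le> L * norm (y - z)"
    by auto
  define r where "r = min r0 r1"
  have "\<bar>f z - f x - grad f x \<bullet> (z - x)\<bar> \<le> L * (norm (z - x))\<^sup>2" if z: "z \<in> cball x r" for z
  proof -
    define \<psi> where "\<psi> y = f y - grad f x \<bullet> y" for y
    have seg: "closed_segment x z \<subseteq> cball x r"
      using z r0 \<open>0 < r1\<close> by (intro closed_segment_subset) (auto simp: r_def)
    have "norm (\<psi> z - \<psi> x) \<le> (L * norm (z - x)) * norm (z - x)"
    proof (rule differentiable_bound[OF convex_closed_segment[of x z]])
      fix y assume y: "y \<in> closed_segment x z"
      then have yr: "y \<in> cball x r" using seg by blast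
      then have "y \<in> S" using r0 by (auto simp: r_def)
      have "(\<psi> has_derivative (\<lambda>h. grad f y \<bullet> h - grad f x \<bullet> h)) (at y)"
        unfolding \<psi>_def by (auto intro!: derivative_eq_intros C2_on_differentiable(1)[OF f \<open>y \<in> S\<close>])
      then show "(\<psi> has_derivative (\<lambda>h. grad f y \<bullet> h - grad f x \<bullet> h)) (at y within closed_segment x z)"
        by (rule has_derivative_at_withinI)
      have "norm (grad f y - grad f x) \<le> L * norm (y - x)"
        using lip yr \<open>0 < r1\<close> by (simp add: r_def)
      also have "\<dots> \<le> L * norm (z - x)"
        using y \<open>0 \<le> L\<close> by (intro mult_left_mono segment_bound1)
      finally have gr: "norm (grad f y - grad f x) \<le> L * norm (z - x)" .
      show "onorm (\<lambda>h. grad f y \<bullet> h - grad f x \<bullet> h) \<le> L * norm (z - x)"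
      proof (rule onorm_le)
        fix h
        have "norm (grad f y \<bullet> h - grad f x \<bullet> h) \<le> norm (grad f y - grad f x) * norm h"
          using Cauchy_Schwarz_ineq2[of "grad f y - grad f x" h] by (simp add: inner_diff_left)
        also have "\<dots> \<le> L * norm (z - x) * norm h" using gr by (intro mult_right_mono) auto
        finally show "norm (grad f y \<bullet> h - grad f x \<bullet> h) \<le> L * norm (z - x) * norm h" .
      qed
    qed auto
    moreover have "\<psi> z - \<psi> x = f z - f x - grad f x \<bullet> (z - x)"
      by (simp add: \<psi>_def inner_diff_right)
    ultimately show ?thesis by (simp add: power2_eq_square mult.assoc)
  qed
  then have "\<exists>C\<ge>0. \<forall>z\<in>cball x r. \<bar>f z - f x - grad f x \<bullet> (z - x)\<bar> \<le> C * (norm (z - x))\<^sup>2"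
    using \<open>0 \<le> L\<close> by auto
  moreover have "0 < r" using r0 \<open>0 < r1\<close> by (simp add: r_def)
  ultimately show ?thesis by auto
qed

text \<open>The remainder of \<open>w\<close> enters linearly through the gradient, and the increment of \<open>w\<close>, which is of
  order \<open>\<epsilon>\<close>, enters quadratically through the Taylor remainder.\<close>

lemma first_order_expansion_compose:
  fixes f :: "real^'n \<Rightarrow> real"
  assumes S: "open S" "x \<in> S" and f: "C2_on S f" and w: "first_order_expansion w x v"
  shows "first_order_expansion (\<lambda>\<epsilon>. f (w \<epsilon>)) (f x) (grad f x \<bullet> v)"
proof -
  obtain r C where C: "0 < r" "0 \<le> C"
    "\<forall>z\<in>cball x r. \<bar>f z - f x - grad f x \<bullet> (z - x)\<bar> \<le> C * (norm (z - x))\<^sup>2"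
    using quadratic_taylor_bound[OF S f] by auto
  obtain D where D: "0 \<le> D" "\<forall>\<^sub>F \<epsilon> in at_right 0. norm (w \<epsilon> - (x + \<epsilon> *\<^sub>R v)) \<le> D * \<epsilon>\<^sup>2"
    using w by (rule first_order_expansionE)
  define m where "m = norm v + 1"
  have "\<forall>\<^sub>F \<epsilon> in at_right 0. norm ((1 / \<epsilon>) *\<^sub>R (w \<epsilon> - x)) < m"
    using order_tendstoD(2)[OF tendsto_norm[OF first_order_expansion_quotient[OF w]], of m]
    by (simp add: m_def)
  moreover have "\<forall>\<^sub>F \<epsilon> in at_right 0. norm (w \<epsilon> - x) < r"
    using tendstoD[OF first_order_expansion_tendsto[OF w] C(1)] by (simp add: dist_norm)
  ultimately have "\<forall>\<^sub>F \<epsilon> in at_right 0. norm (norm (f (w \<epsilon>) - (f x + \<epsilon> *\<^sub>R (grad f x \<bullet> v))))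
      \<le> (C * m\<^sup>2 + norm (grad f x) * D) * norm (\<epsilon>\<^sup>2)"
    using D(2) eventually_at_right_less[of 0]
  proof eventually_elim
    case (elim \<epsilon>)
    have "norm (w \<epsilon> - x) / \<epsilon> < m" using elim by simp
    then have "norm (w \<epsilon> - x) \<le> m * \<epsilon>" using elim by (simp add: pos_divide_less_eq)
    then have "(norm (w \<epsilon> - x))\<^sup>2 \<le> (m * \<epsilon>)\<^sup>2" by (intro power_mono) auto
    then have "C * (norm (w \<epsilon> - x))\<^sup>2 \<le> C * (m\<^sup>2 * \<epsilon>\<^sup>2)"
      using C(2) by (intro mult_left_mono) (simp_all add: power_mult_distrib)
    moreover have "\<bar>f (w \<epsilon>) - f x - grad f x \<bullet> (w \<epsilon> - x)\<bar> \<le> C * (norm (w \<epsilon> - x))\<^sup>2"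
      using elim by (intro C(3)[rule_format]) (simp add: dist_norm norm_minus_commute)
    moreover have "\<bar>grad f x \<bullet> (w \<epsilon> - (x + \<epsilon> *\<^sub>R v))\<bar> \<le> norm (grad f x) * (D * \<epsilon>\<^sup>2)"
      using elim by (intro order_trans[OF Cauchy_Schwarz_ineq2] mult_left_mono) auto
    moreover have "f (w \<epsilon>) - (f x + \<epsilon> * (grad f x \<bullet> v))
        = (f (w \<epsilon>) - f x - grad f x \<bullet> (w \<epsilon> - x)) + grad f x \<bullet> (w \<epsilon> - (x + \<epsilon> *\<^sub>R v))"
      by (simp add: inner_diff_right inner_add_right)
    ultimately show ?case by (simp add: algebra_simps)
  qed
  then show ?thesis unfolding first_order_expansion_def by (rule bigoI)
qed

section \<open>The cost of a bounded control\<close>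

lemma control_field_locally_lipschitz:
  assumes \<Theta>: "open \<Theta>" "z \<in> \<Theta>" and C2: "C2_on \<Theta> J" "C2_on \<Theta> Jn"
    and u: "\<And>t. t \<in> I \<Longrightarrow> \<bar>u t\<bar> \<le> C"
  shows "\<exists>r>0. \<exists>L\<ge>0. \<forall>t\<in>I. \<forall>a\<in>ball z r. \<forall>b\<in>ball z r.
    norm (control_field J Jn \<epsilon> (u t) a - control_field J Jn \<epsilon> (u t) b) \<le> L * norm (a - b)"
proof -
  have z: "{z} \<subseteq> \<Theta>" using \<Theta> by simp
  from C1_lipschitz_near_compact[OF \<Theta>(1) compact_sing z C2_on_differentiable(2)[OF C2(1)] C2_on_continuous(2)[OF C2(1)]]
  obtain r1 L1 where "r1 > 0" "L1 \<ge> 0"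
    and L1: "\<forall>a\<in>cball z r1. \<forall>b\<in>cball z r1. norm (grad J a - grad J b) \<le> L1 * norm (a - b)"
    by auto
  have "continuous_on \<Theta> (\<lambda>x. \<chi> i j. 2 * grad Jn x $ i * hessian Jn x $ i $ j)"
    by (intro continuous_intros C2_on_continuous[OF C2(2)])
  from C1_lipschitz_near_compact[OF \<Theta>(1) compact_sing z sq_grad_has_derivative[OF C2(2)] this]
  obtain r2 L2 where "r2 > 0" "L2 \<ge> 0"
    and L2: "\<forall>a\<in>cball z r2. \<forall>b\<in>cball z r2. norm (sq_grad Jn a - sq_grad Jn b) \<le> L2 * norm (a - b)"
    by auto
  define r where "r = min r1 r2"
  define L where "L = L1 + \<bar>\<epsilon>\<bar> * \<bar>C\<bar> * L2"
  have "norm (control_field J Jn \<epsilon> (u t) a - control_field J Jn \<epsilon> (u t) b) \<le> L * norm (a - b)"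
    if t: "t \<in> I" and ab: "a \<in> ball z r" "b \<in> ball z r" for t a b
  proof -
    have "control_field J Jn \<epsilon> (u t) a - control_field J Jn \<epsilon> (u t) b
        = - (grad J a - grad J b) + (\<epsilon> * u t) *\<^sub>R (sq_grad Jn a - sq_grad Jn b)"
      by (simp add: control_field_def scaleR_diff_right)
    also have "norm \<dots> \<le> norm (grad J a - grad J b) + \<bar>\<epsilon>\<bar> * \<bar>u t\<bar> * norm (sq_grad Jn a - sq_grad Jn b)"
      using norm_triangle_ineq[of "- (grad J a - grad J b)" "(\<epsilon> * u t) *\<^sub>R (sq_grad Jn a - sq_grad Jn b)"]
      by (simp only: norm_minus_cancel norm_scaleR abs_mult)
    also have "\<dots> \<le> L1 * norm (a - b) + \<bar>\<epsilon>\<bar> * \<bar>C\<bar> * (L2 * norm (a - b))"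
    proof (intro add_mono mult_mono)
      show "norm (grad J a - grad J b) \<le> L1 * norm (a - b)" using L1 ab by (simp add: r_def)
      show "norm (sq_grad Jn a - sq_grad Jn b) \<le> L2 * norm (a - b)" using L2 ab by (simp add: r_def)
      show "\<bar>u t\<bar> \<le> \<bar>C\<bar>" using u[OF t] by linarith
    qed auto
    finally show ?thesis by (simp add: L_def algebra_simps)
  qed
  then have "\<forall>t\<in>I. \<forall>a\<in>ball z r. \<forall>b\<in>ball z r.
      norm (control_field J Jn \<epsilon> (u t) a - control_field J Jn \<epsilon> (u t) b) \<le> L * norm (a - b)"
    by (intro ballI)
  moreover have "L \<ge> 0" using \<open>L1 \<ge> 0\<close> \<open>L2 \<ge> 0\<close> by (simp add: L_def)
  ultimately have "\<exists>L\<ge>0. \<forall>t\<in>I. \<forall>a\<in>ball z r. \<forall>b\<in>ball z r.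
      norm (control_field J Jn \<epsilon> (u t) a - control_field J Jn \<epsilon> (u t) b) \<le> L * norm (a - b)"
    by (intro exI[of _ L] conjI)
  moreover have "r > 0" using \<open>r1 > 0\<close> \<open>r2 > 0\<close> by (simp add: r_def)
  ultimately show ?thesis by (rule_tac x = r in exI) (rule conjI)
qed

lemma is_state_primitive_on:
  "is_state \<Theta> T \<theta>init J Jn \<epsilon> u \<theta> \<Longrightarrow> primitive_on T (\<lambda>t. control_field J Jn \<epsilon> (u t) (\<theta> t)) \<theta>"
  unfolding is_state_def by (intro ae_ode_solution_imp_primitive_on) simp

text \<open>All states of a bounded control have the same terminal value, so the description in the cost
  functional selects it.\<close>

lemma cost_eq:
  assumes \<Theta>: "open \<Theta>" and C2: "C2_on \<Theta> J" "C2_on \<Theta> Jn" and "0 \<le> T"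
    and u: "bounded (u ` {0..T})" and \<theta>: "is_state \<Theta> T \<theta>init J Jn \<epsilon> u \<theta>"
  shows "cost \<Theta> T \<theta>init J Jn \<phi> \<epsilon> u = \<phi> (\<theta> T)"
proof -
  obtain C where "\<forall>v\<in>u ` {0..T}. norm v \<le> C"
    using u unfolding bounded_iff by auto
  then have C: "\<bar>u t\<bar> \<le> C" if "t \<in> {0..T}" for t using that by simp
  have unique: "x T = \<theta> T" if x: "is_state \<Theta> T \<theta>init J Jn \<epsilon> u x" for x
  proof (rule ae_ode_unique[where F = "\<lambda>t. control_field J Jn \<epsilon> (u t)" and S = \<Theta> and T = T])
    show "\<exists>r>0. \<exists>L\<ge>0. \<forall>t\<in>{0..T}. \<forall>a\<in>ball z r. \<forall>b\<in>ball z r.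
        norm (control_field J Jn \<epsilon> (u t) a - control_field J Jn \<epsilon> (u t) b) \<le> L * norm (a - b)"
      if "z \<in> \<Theta>" for z
      using control_field_locally_lipschitz[OF \<Theta> that C2 C] .
    show "x 0 = \<theta> 0" "\<And>t. t \<in> {0..T} \<Longrightarrow> x t \<in> \<Theta>" using x \<theta> by (simp_all add: is_state_def)
  qed (use x \<theta> \<open>0 \<le> T\<close> in \<open>simp_all add: is_state_primitive_on\<close>)
  have "(THE x. \<exists>\<theta>. is_state \<Theta> T \<theta>init J Jn \<epsilon> u \<theta> \<and> x = \<theta> T) = \<theta> T"
  proof (rule the_equality)
    show "\<exists>\<theta>'. is_state \<Theta> T \<theta>init J Jn \<epsilon> u \<theta>' \<and> \<theta> T = \<theta>' T" using \<theta> by auto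
  qed (use unique in auto)
  then show ?thesis by (simp add: cost_def)
qed

section \<open>Limits of perturbed states and costates\<close>

text \<open>The optimal states and controls as a family of solutions of the perturbed equations that converges
  at each time. The costate equation and the maximum condition are hypotheses of the lemmas that
  concern them, so that the first-order equation of the states is a statement about states alone.\<close>

locale perturbed_states =
  fixes \<Theta> :: "(real^'p) set" and T :: real and \<theta>init :: "real^'p" and J Jn :: "real^'p \<Rightarrow> real"
    and U :: "real set" and \<epsilon>max :: real and \<theta> :: "real \<Rightarrow> real \<Rightarrow> real^'p" and u :: "real \<Rightarrow> real \<Rightarrow> real"
    and \<theta>0 \<theta>1 :: "real \<Rightarrow> real^'p" and u0 :: "real \<Rightarrow> real"
  assumes open_\<Theta>: "open \<Theta>" and T_pos: "0 < T" and \<epsilon>max_pos: "0 < \<epsilon>max"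
    and J_C2: "C2_on \<Theta> J" and Jn_C2: "C2_on \<Theta> Jn" and U_bounded: "bounded U"
    and states: "\<And>\<epsilon>. \<epsilon> \<in> {0<..<\<epsilon>max} \<Longrightarrow> is_state \<Theta> T \<theta>init J Jn \<epsilon> (u \<epsilon>) (\<theta> \<epsilon>)"
    and controls: "\<And>\<epsilon> t. \<epsilon> \<in> {0<..<\<epsilon>max} \<Longrightarrow> t \<in> {0..T} \<Longrightarrow> u \<epsilon> t \<in> U"
    and expansion: "\<And>t. t \<in> {0..T} \<Longrightarrow> first_order_expansion (\<lambda>\<epsilon>. \<theta> \<epsilon> t) (\<theta>0 t) (\<theta>1 t)"
    and control_limit: "\<And>t. t \<in> {0..T} \<Longrightarrow> ((\<lambda>\<epsilon>. u \<epsilon> t) \<longlongrightarrow> u0 t) (at_right 0)"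
    and \<theta>0_in: "\<And>t. t \<in> {0..T} \<Longrightarrow> \<theta>0 t \<in> \<Theta>"
begin

lemma state_limit: "t \<in> {0..T} \<Longrightarrow> ((\<lambda>\<epsilon>. \<theta> \<epsilon> t) \<longlongrightarrow> \<theta>0 t) (at_right 0)"
  by (rule first_order_expansion_tendsto[OF expansion])

lemma eventually_small: "\<forall>\<^sub>F \<epsilon> in at_right 0. \<epsilon> \<in> {0<..<\<epsilon>max}"
  using \<epsilon>max_pos by (rule eventually_at_right_real)

lemma states_primitive:
  "\<forall>\<^sub>F \<epsilon> in at_right 0. primitive_on T (\<lambda>t. control_field J Jn \<epsilon> (u \<epsilon> t) (\<theta> \<epsilon> t)) (\<theta> \<epsilon>)"
  using eventually_small by eventually_elim (rule is_state_primitive_on[OF states])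

lemma control_bound: "\<exists>C\<ge>0. \<forall>\<^sub>F \<epsilon> in at_right 0. \<forall>t\<in>{0..T}. \<bar>u \<epsilon> t\<bar> \<le> C"
proof -
  obtain C where C: "C > 0" "\<And>v. v \<in> U \<Longrightarrow> \<bar>v\<bar> \<le> C" using U_bounded unfolding bounded_pos by auto
  have "\<forall>\<^sub>F \<epsilon> in at_right 0. \<forall>t\<in>{0..T}. \<bar>u \<epsilon> t\<bar> \<le> C"
    using eventually_small by eventually_elim (intro ballI C(2) controls)
  then show ?thesis using C(1) by (intro exI[of _ C]) simp
qed

lemma perturbation_limit:
  assumes t: "t \<in> {0..T}"
  shows "((\<lambda>\<epsilon>. \<epsilon> * u \<epsilon> t) \<longlongrightarrow> 0) (at_right 0)"
  using tendsto_mult[OF tendsto_ident_at control_limit[OF t]] by simp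

lemma limit_along_states:
  assumes f: "continuous_on \<Theta> f" and t: "t \<in> {0..T}"
  shows "((\<lambda>\<epsilon>. f (\<theta> \<epsilon> t)) \<longlongrightarrow> f (\<theta>0 t)) (at_right 0)"
proof -
  have "isCont f (\<theta>0 t)" using f open_\<Theta> \<theta>0_in[OF t] by (simp add: continuous_on_eq_continuous_at)
  then show ?thesis using state_limit[OF t] by (rule isCont_tendsto_compose)
qed

text \<open>The perturbation has the factor \<open>\<epsilon> < 1\<close> and a bounded control, so on a compact subset of \<open>\<Theta>\<close> the
  control fields are bounded uniformly in \<open>\<epsilon>\<close>.\<close>

lemma states_in_compact:
  "\<exists>K M. compact K \<and> K \<subseteq> \<Theta> \<and> (\<forall>\<^sub>F \<epsilon> in at_right 0. \<forall>t\<in>{0..T}. \<theta> \<epsilon> t \<in> K \<and>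
     norm (control_field J Jn \<epsilon> (u \<epsilon> t) (\<theta> \<epsilon> t)) \<le> M)"
proof (rule primitive_on_family_bounded[OF open_\<Theta> states_primitive state_limit \<theta>0_in])
  fix K assume K: "compact K" "K \<subseteq> \<Theta>"
  obtain A where A: "\<forall>x\<in>K. norm (grad J x) \<le> A"
    using compact_continuous_image_bounded[OF K(1) continuous_on_subset[OF C2_on_continuous(1)[OF J_C2] K(2)]] by auto
  obtain B where B: "\<forall>x\<in>K. norm (sq_grad Jn x) \<le> B"
    using compact_continuous_image_bounded[OF K(1) continuous_on_subset[OF sq_grad_continuous(1)[OF Jn_C2] K(2)]] by auto
  obtain C where C: "0 \<le> C" "\<forall>\<^sub>F \<epsilon> in at_right 0. \<forall>t\<in>{0..T}. \<bar>u \<epsilon> t\<bar> \<le> C"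
    using control_bound by auto
  have "\<forall>\<^sub>F \<epsilon> in at_right 0. \<forall>t\<in>{0..T}. \<theta> \<epsilon> t \<in> K \<longrightarrow>
      norm (control_field J Jn \<epsilon> (u \<epsilon> t) (\<theta> \<epsilon> t)) \<le> A + 1 * C * B"
    using C(2) eventually_at_right_real[OF zero_less_one]
  proof eventually_elim
    case (elim \<epsilon>)
    show ?case
    proof (intro ballI impI)
      fix t assume t: "t \<in> {0..T}" "\<theta> \<epsilon> t \<in> K"
      have "norm (control_field J Jn \<epsilon> (u \<epsilon> t) (\<theta> \<epsilon> t)) \<le>
          norm (grad J (\<theta> \<epsilon> t)) + \<bar>\<epsilon>\<bar> * \<bar>u \<epsilon> t\<bar> * norm (sq_grad Jn (\<theta> \<epsilon> t))"
        unfolding control_field_def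
        using norm_triangle_ineq[of "- grad J (\<theta> \<epsilon> t)" "(\<epsilon> * u \<epsilon> t) *\<^sub>R sq_grad Jn (\<theta> \<epsilon> t)"]
        by (simp only: norm_minus_cancel norm_scaleR abs_mult)
      also have "\<dots> \<le> A + 1 * C * B"
        using A B C(1) elim t by (intro add_mono mult_mono) auto
      finally show "norm (control_field J Jn \<epsilon> (u \<epsilon> t) (\<theta> \<epsilon> t)) \<le> A + 1 * C * B" .
    qed
  qed
  then show "\<exists>M. \<forall>\<^sub>F \<epsilon> in at_right 0. \<forall>t\<in>{0..T}. \<theta> \<epsilon> t \<in> K \<longrightarrow>
      norm (control_field J Jn \<epsilon> (u \<epsilon> t) (\<theta> \<epsilon> t)) \<le> M" by (rule exI)
qed

lemma states_in_compactE:
  obtains K M where "compact K" "K \<subseteq> \<Theta>" "\<forall>\<^sub>F \<epsilon> in at_right 0. \<forall>t\<in>{0..T}. \<theta> \<epsilon> t \<in> K"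
    "\<forall>\<^sub>F \<epsilon> in at_right 0. \<forall>t\<in>{0..T}. norm (control_field J Jn \<epsilon> (u \<epsilon> t) (\<theta> \<epsilon> t)) \<le> M"
proof -
  obtain K M where K: "compact K" "K \<subseteq> \<Theta>" and ev: "\<forall>\<^sub>F \<epsilon> in at_right 0. \<forall>t\<in>{0..T}. \<theta> \<epsilon> t \<in> K \<and>
     norm (control_field J Jn \<epsilon> (u \<epsilon> t) (\<theta> \<epsilon> t)) \<le> M"
    using states_in_compact by (elim exE conjE)
  show thesis
    by (rule that[of K M, OF K eventually_mono[OF ev] eventually_mono[OF ev]]) simp_all
qed

lemma zeroth_order_state: "primitive_on T (\<lambda>t. - grad J (\<theta>0 t)) \<theta>0"
proof -
  obtain M where M: "\<forall>\<^sub>F \<epsilon> in at_right 0. \<forall>t\<in>{0..T}. norm (control_field J Jn \<epsilon> (u \<epsilon> t) (\<theta> \<epsilon> t)) \<le> M"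
    by (rule states_in_compactE)
  show ?thesis
  proof (rule primitive_on_limit(1)[OF states_primitive M state_limit])
    fix t assume t: "t \<in> {0..T}"
    have "((\<lambda>\<epsilon>. - grad J (\<theta> \<epsilon> t) + (\<epsilon> * u \<epsilon> t) *\<^sub>R sq_grad Jn (\<theta> \<epsilon> t)) \<longlongrightarrow>
        - grad J (\<theta>0 t) + 0 *\<^sub>R sq_grad Jn (\<theta>0 t)) (at_right 0)"
      by (intro tendsto_intros limit_along_states perturbation_limit t C2_on_continuous(1)[OF J_C2]
          sq_grad_continuous(1)[OF Jn_C2])
    then show "((\<lambda>\<epsilon>. control_field J Jn \<epsilon> (u \<epsilon> t) (\<theta> \<epsilon> t)) \<longlongrightarrow> - grad J (\<theta>0 t)) (at_right 0)"
      by (simp add: control_field_def)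
  qed
qed

lemma zeroth_order_state_continuous: "continuous_on {0..T} \<theta>0"
  by (rule primitive_on_continuous[OF zeroth_order_state])

lemma zeroth_order_state_ode:
  assumes "t \<in> {0..T}"
  shows "(\<theta>0 has_vector_derivative - grad J (\<theta>0 t)) (at t within {0..T})"
proof (rule primitive_on_has_vector_derivative[OF zeroth_order_state _ assms])
  show "continuous_on {0..T} (\<lambda>t. - grad J (\<theta>0 t))"
    by (intro continuous_intros continuous_on_compose2[OF C2_on_continuous(1)[OF J_C2] zeroth_order_state_continuous])
      (use \<theta>0_in in auto)
qed

lemma initial_values: "\<theta>0 0 = \<theta>init" "\<theta>1 0 = 0"
proof -
  have 0: "0 \<in> {0..T}" using T_pos by simp
  have init: "\<forall>\<^sub>F \<epsilon> in at_right 0. \<theta> \<epsilon> 0 = \<theta>init"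
    using eventually_small by eventually_elim (use states in \<open>auto simp: is_state_def\<close>)
  then have "((\<lambda>\<epsilon>. \<theta> \<epsilon> 0) \<longlongrightarrow> \<theta>init) (at_right 0)" by (rule tendsto_eventually)
  then show \<theta>0: "\<theta>0 0 = \<theta>init"
    using tendsto_unique[OF _ state_limit[OF 0]] by simp
  have "\<forall>\<^sub>F \<epsilon> in at_right 0. (1 / \<epsilon>) *\<^sub>R (\<theta> \<epsilon> 0 - \<theta>0 0) = 0"
    using init by eventually_elim (simp add: \<theta>0)
  then have "((\<lambda>\<epsilon>. (1 / \<epsilon>) *\<^sub>R (\<theta> \<epsilon> 0 - \<theta>0 0)) \<longlongrightarrow> 0) (at_right 0)" by (rule tendsto_eventually)
  then show "\<theta>1 0 = 0"
    using tendsto_unique[OF _ first_order_expansion_quotient[OF expansion[OF 0]]] by simp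
qed

text \<open>The difference quotients \<open>y \<epsilon>\<close> are curves whose velocities \<open>g \<epsilon>\<close> contain the difference quotients
  of \<open>grad J\<close> along the states. While \<open>y \<epsilon>\<close> stays in a bounded set, the states deviate from \<open>\<theta>0\<close> by
  \<open>O(\<epsilon>)\<close>, and the Lipschitz bound for \<open>grad J\<close> near the curve \<open>\<theta>0\<close> keeps \<open>g \<epsilon>\<close> bounded. Thus the
  compactness argument yields the uniform bounds on \<open>y \<epsilon>\<close> that the pointwise expansion does not state.\<close>

lemma first_order_state:
  "ae_ode_solution T (\<lambda>t x. - (hessian J (\<theta>0 t) *v x) + u0 t *\<^sub>R sq_grad Jn (\<theta>0 t)) \<theta>1"
proof -
  define y where "y \<epsilon> t = (1 / \<epsilon>) *\<^sub>R (\<theta> \<epsilon> t - \<theta>0 t)" for \<epsilon> t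
  define g where "g \<epsilon> t = (1 / \<epsilon>) *\<^sub>R (control_field J Jn \<epsilon> (u \<epsilon> t) (\<theta> \<epsilon> t) - - grad J (\<theta>0 t))" for \<epsilon> t
  define g0 where "g0 t = - (hessian J (\<theta>0 t) *v \<theta>1 t) + u0 t *\<^sub>R sq_grad Jn (\<theta>0 t)" for t
  have y_primitive: "\<forall>\<^sub>F \<epsilon> in at_right 0. primitive_on T (g \<epsilon>) (y \<epsilon>)"
    using states_primitive
  proof eventually_elim
    case (elim \<epsilon>)
    show ?case unfolding y_def[abs_def] g_def[abs_def]
      by (intro primitive_on_scaleR primitive_on_diff elim zeroth_order_state)
  qed
  have y_limit: "((\<lambda>\<epsilon>. y \<epsilon> t) \<longlongrightarrow> \<theta>1 t) (at_right 0)" if "t \<in> {0..T}" for t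
    unfolding y_def by (rule first_order_expansion_quotient[OF expansion[OF that]])
  have g_eq: "g \<epsilon> t = - ((1 / \<epsilon>) *\<^sub>R (grad J (\<theta> \<epsilon> t) - grad J (\<theta>0 t))) + u \<epsilon> t *\<^sub>R sq_grad Jn (\<theta> \<epsilon> t)"
    if "0 < \<epsilon>" for \<epsilon> t
    using that by (simp add: g_def control_field_def algebra_simps)
  have g_limit: "((\<lambda>\<epsilon>. g \<epsilon> t) \<longlongrightarrow> g0 t) (at_right 0)" if t: "t \<in> {0..T}" for t
  proof -
    have "((\<lambda>\<epsilon>. - ((1 / \<epsilon>) *\<^sub>R (grad J (\<theta> \<epsilon> t) - grad J (\<theta>0 t))) + u \<epsilon> t *\<^sub>R sq_grad Jn (\<theta> \<epsilon> t))
        \<longlongrightarrow> g0 t) (at_right 0)"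
      unfolding g0_def
      by (intro tendsto_intros control_limit t limit_along_states sq_grad_continuous(1)[OF Jn_C2]
          has_derivative_quotient_tendsto[OF C2_on_differentiable(2)[OF J_C2 \<theta>0_in[OF t]]]
          first_order_expansion_quotient[OF expansion[OF t]])
    moreover have "\<forall>\<^sub>F \<epsilon> in at_right 0. g \<epsilon> t =
        - ((1 / \<epsilon>) *\<^sub>R (grad J (\<theta> \<epsilon> t) - grad J (\<theta>0 t))) + u \<epsilon> t *\<^sub>R sq_grad Jn (\<theta> \<epsilon> t)"
      using eventually_at_right_less[of 0] by eventually_elim (rule g_eq)
    ultimately show ?thesis by (simp only: tendsto_cong)
  qed
  have bound: "\<exists>M. \<forall>\<^sub>F \<epsilon> in at_right 0. \<forall>t\<in>{0..T}. y \<epsilon> t \<in> K \<longrightarrow> norm (g \<epsilon> t) \<le> M" if K: "compact K" for K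
  proof -
    obtain R where R: "R > 0" "\<forall>x\<in>K. norm x \<le> R"
      using compact_imp_bounded[OF K] unfolding bounded_pos by auto
    obtain K' where K': "compact K'" "K' \<subseteq> \<Theta>" "\<forall>\<^sub>F \<epsilon> in at_right 0. \<forall>t\<in>{0..T}. \<theta> \<epsilon> t \<in> K'"
      by (rule states_in_compactE)
    obtain B where B: "\<forall>x\<in>K'. norm (sq_grad Jn x) \<le> B"
      using compact_continuous_image_bounded[OF K'(1) continuous_on_subset[OF sq_grad_continuous(1)[OF Jn_C2] K'(2)]]
      by auto
    obtain C where C: "0 \<le> C" "\<forall>\<^sub>F \<epsilon> in at_right 0. \<forall>t\<in>{0..T}. \<bar>u \<epsilon> t\<bar> \<le> C"
      using control_bound by auto
    have K0: "compact (\<theta>0 ` {0..T})" "\<theta>0 ` {0..T} \<subseteq> \<Theta>"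
      using \<theta>0_in by (auto intro: compact_continuous_image zeroth_order_state_continuous)
    have "\<exists>r>0. \<exists>L\<ge>0. \<forall>x\<in>\<theta>0 ` {0..T}. \<forall>a\<in>cball x r. \<forall>b\<in>cball x r.
        norm (grad J a - grad J b) \<le> L * norm (a - b)"
      by (rule C1_lipschitz_near_compact[OF open_\<Theta> K0 C2_on_differentiable(2)[OF J_C2] C2_on_continuous(2)[OF J_C2]])
    then obtain r L where "r > 0" "L \<ge> 0"
      and L: "\<forall>x\<in>\<theta>0 ` {0..T}. \<forall>a\<in>cball x r. \<forall>b\<in>cball x r. norm (grad J a - grad J b) \<le> L * norm (a - b)"
      by (elim exE conjE)
    \<comment> \<open>For \<open>\<epsilon> < r / R\<close> and \<open>norm (y \<epsilon> t) \<le> R\<close> the state lies in the ball where \<open>grad J\<close> is Lipschitz.\<close>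
    have "r / R > 0" using \<open>r > 0\<close> \<open>R > 0\<close> by simp
    then have "\<forall>\<^sub>F \<epsilon> in at_right 0. \<epsilon> \<in> {0<..<r / R}" by (rule eventually_at_right_real)
    then have "\<forall>\<^sub>F \<epsilon> in at_right 0. \<forall>t\<in>{0..T}. y \<epsilon> t \<in> K \<longrightarrow> norm (g \<epsilon> t) \<le> L * R + C * B"
      using C(2) K'(3)
    proof eventually_elim
      case (elim \<epsilon>)
      then have "\<epsilon> > 0" "\<epsilon> * R \<le> r" using \<open>R > 0\<close> by (auto simp: field_simps)
      show ?case
      proof (intro ballI impI)
        fix t assume t: "t \<in> {0..T}" "y \<epsilon> t \<in> K"
        have dist: "norm (\<theta> \<epsilon> t - \<theta>0 t) = \<epsilon> * norm (y \<epsilon> t)"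
          using \<open>\<epsilon> > 0\<close> by (simp add: y_def del: scaleR_diff_right)
        also have "\<dots> \<le> \<epsilon> * R" using R t \<open>\<epsilon> > 0\<close> by (intro mult_left_mono) auto
        finally have small: "norm (\<theta> \<epsilon> t - \<theta>0 t) \<le> \<epsilon> * R" .
        then have "\<theta> \<epsilon> t \<in> cball (\<theta>0 t) r" "\<theta>0 t \<in> cball (\<theta>0 t) r"
          using \<open>\<epsilon> * R \<le> r\<close> \<open>r > 0\<close> by (auto simp: dist_norm norm_minus_commute)
        moreover have "\<theta>0 t \<in> \<theta>0 ` {0..T}" using t(1) by (rule imageI)
        ultimately have "norm (grad J (\<theta> \<epsilon> t) - grad J (\<theta>0 t)) \<le> L * norm (\<theta> \<epsilon> t - \<theta>0 t)"
          using L by blast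
        also have "\<dots> \<le> L * (\<epsilon> * R)" using small \<open>L \<ge> 0\<close> by (rule mult_left_mono)
        finally have "norm (grad J (\<theta> \<epsilon> t) - grad J (\<theta>0 t)) / \<epsilon> \<le> L * R"
          using \<open>\<epsilon> > 0\<close> by (simp add: pos_divide_le_eq mult_ac)
        then have 1: "norm ((1 / \<epsilon>) *\<^sub>R (grad J (\<theta> \<epsilon> t) - grad J (\<theta>0 t))) \<le> L * R"
          using \<open>\<epsilon> > 0\<close> by simp
        have "\<bar>u \<epsilon> t\<bar> \<le> C" "norm (sq_grad Jn (\<theta> \<epsilon> t)) \<le> B" using elim t B by auto
        then have 2: "norm (u \<epsilon> t *\<^sub>R sq_grad Jn (\<theta> \<epsilon> t)) \<le> C * B"
          using C(1) unfolding norm_scaleR by (intro mult_mono) auto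
        show "norm (g \<epsilon> t) \<le> L * R + C * B"
          unfolding g_eq[OF \<open>\<epsilon> > 0\<close>]
          by (rule order_trans[OF norm_triangle_ineq add_mono[OF _ 2]]) (use 1 in \<open>simp only: norm_minus_cancel\<close>)
      qed
    qed
    then show ?thesis by (rule exI)
  qed
  have "\<exists>K M. compact K \<and> K \<subseteq> UNIV \<and> (\<forall>\<^sub>F \<epsilon> in at_right 0. \<forall>t\<in>{0..T}. y \<epsilon> t \<in> K \<and> norm (g \<epsilon> t) \<le> M)"
    by (rule primitive_on_family_bounded[OF open_UNIV y_primitive y_limit UNIV_I bound])
  then obtain K M where "\<forall>\<^sub>F \<epsilon> in at_right 0. \<forall>t\<in>{0..T}. y \<epsilon> t \<in> K \<and> norm (g \<epsilon> t) \<le> M"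
    by (elim exE conjE)
  then have M: "\<forall>\<^sub>F \<epsilon> in at_right 0. \<forall>t\<in>{0..T}. norm (g \<epsilon> t) \<le> M"
    by (rule eventually_mono) simp
  show ?thesis
  proof (rule primitive_on_imp_ae_ode_solution)
    show "primitive_on T g0 \<theta>1" by (rule primitive_on_limit(1)[OF y_primitive M y_limit g_limit])
    show "norm (g0 t) \<le> M" if "t \<in> {0..T}" for t
      using primitive_on_limit(2)[OF y_primitive M y_limit g_limit that] .
  qed (use T_pos in \<open>simp_all add: g0_def\<close>)
qed

text \<open>The costate fields are linear in the costate, with coefficients that are continuous functions of
  the state; these are bounded because the states lie in a fixed compact set.\<close>

lemma zeroth_order_costate:
  assumes costates: "\<And>\<epsilon>. \<epsilon> \<in> {0<..<\<epsilon>max} \<Longrightarrow>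
      ae_ode_solution T (\<lambda>t. costate_field J Jn \<epsilon> (u \<epsilon> t) (\<theta> \<epsilon> t)) (p \<epsilon>)"
    and p_limit: "\<And>t. t \<in> {0..T} \<Longrightarrow> ((\<lambda>\<epsilon>. p \<epsilon> t) \<longlongrightarrow> p0 t) (at_right 0)"
    and t: "t \<in> {0..T}"
  shows "(p0 has_vector_derivative hessian J (\<theta>0 t) *v p0 t) (at t within {0..T})"
proof -
  define g where "g \<epsilon> t = costate_field J Jn \<epsilon> (u \<epsilon> t) (\<theta> \<epsilon> t) (p \<epsilon> t)" for \<epsilon> t
  define D where "D x = transpose (jacobian (sq_grad Jn) (at x))" for x
  have g_eq: "g \<epsilon> t = hessian J (\<theta> \<epsilon> t) *v p \<epsilon> t - (\<epsilon> * u \<epsilon> t) *\<^sub>R (D (\<theta> \<epsilon> t) *v p \<epsilon> t)" for \<epsilon> t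
    by (simp add: g_def costate_field_def D_def)
  have D: "continuous_on \<Theta> D" unfolding D_def[abs_def] by (rule sq_grad_continuous(2)[OF Jn_C2])
  have primitive: "\<forall>\<^sub>F \<epsilon> in at_right 0. primitive_on T (g \<epsilon>) (p \<epsilon>)"
    using eventually_small unfolding g_def[abs_def]
    by eventually_elim (rule ae_ode_solution_imp_primitive_on[OF costates])
  have g_limit: "((\<lambda>\<epsilon>. g \<epsilon> t) \<longlongrightarrow> hessian J (\<theta>0 t) *v p0 t) (at_right 0)" if t: "t \<in> {0..T}" for t
  proof -
    have "((\<lambda>\<epsilon>. g \<epsilon> t) \<longlongrightarrow> hessian J (\<theta>0 t) *v p0 t - 0 *\<^sub>R (D (\<theta>0 t) *v p0 t)) (at_right 0)"
      unfolding g_eq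
      by (intro tendsto_intros tendsto_matrix_vector perturbation_limit p_limit limit_along_states t D
          C2_on_continuous(2)[OF J_C2])
    then show ?thesis by simp
  qed
  have bound: "\<exists>M. \<forall>\<^sub>F \<epsilon> in at_right 0. \<forall>t\<in>{0..T}. p \<epsilon> t \<in> K \<longrightarrow> norm (g \<epsilon> t) \<le> M" if K: "compact K" for K
  proof -
    obtain R where R: "R > 0" "\<forall>x\<in>K. norm x \<le> R"
      using compact_imp_bounded[OF K] unfolding bounded_pos by auto
    obtain K' where K': "compact K'" "K' \<subseteq> \<Theta>" "\<forall>\<^sub>F \<epsilon> in at_right 0. \<forall>t\<in>{0..T}. \<theta> \<epsilon> t \<in> K'"
      by (rule states_in_compactE)
    obtain A where A: "0 \<le> A" "\<forall>x\<in>K'. norm (hessian J x) \<le> A"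
      using compact_continuous_image_bounded[OF K'(1) continuous_on_subset[OF C2_on_continuous(2)[OF J_C2] K'(2)]]
      by auto
    obtain B where B: "0 \<le> B" "\<forall>x\<in>K'. norm (D x) \<le> B"
      using compact_continuous_image_bounded[OF K'(1) continuous_on_subset[OF D K'(2)]] by auto
    obtain C where C: "0 \<le> C" "\<forall>\<^sub>F \<epsilon> in at_right 0. \<forall>t\<in>{0..T}. \<bar>u \<epsilon> t\<bar> \<le> C"
      using control_bound by auto
    have "\<forall>\<^sub>F \<epsilon> in at_right 0. \<forall>t\<in>{0..T}. p \<epsilon> t \<in> K \<longrightarrow> norm (g \<epsilon> t) \<le> A * R + 1 * C * (B * R)"
      using C(2) K'(3) eventually_at_right_real[OF zero_less_one]
    proof eventually_elim
      case (elim \<epsilon>)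
      show ?case
      proof (intro ballI impI)
        fix t assume t: "t \<in> {0..T}" "p \<epsilon> t \<in> K"
        have \<theta>: "\<theta> \<epsilon> t \<in> K'" and p: "norm (p \<epsilon> t) \<le> R" using elim t R by auto
        have mv: "norm (X *v p \<epsilon> t) \<le> b * R" if "norm X \<le> b" "0 \<le> b" for X :: "real^'p^'p" and b
          using norm_matrix_vector_le[of X "p \<epsilon> t"] mult_mono[OF that(1) p that(2)] by simp
        have "norm (g \<epsilon> t) \<le> norm (hessian J (\<theta> \<epsilon> t) *v p \<epsilon> t) + \<bar>\<epsilon>\<bar> * \<bar>u \<epsilon> t\<bar> * norm (D (\<theta> \<epsilon> t) *v p \<epsilon> t)"
          unfolding g_eq
          using norm_triangle_ineq4[of "hessian J (\<theta> \<epsilon> t) *v p \<epsilon> t" "(\<epsilon> * u \<epsilon> t) *\<^sub>R (D (\<theta> \<epsilon> t) *v p \<epsilon> t)"]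
          by (simp only: norm_scaleR abs_mult)
        also have "\<dots> \<le> A * R + 1 * C * (B * R)"
        proof (intro add_mono mult_mono)
          show "norm (hessian J (\<theta> \<epsilon> t) *v p \<epsilon> t) \<le> A * R" "norm (D (\<theta> \<epsilon> t) *v p \<epsilon> t) \<le> B * R"
            using A B \<theta> by (intro mv; simp)+
          show "\<bar>u \<epsilon> t\<bar> \<le> C" "\<bar>\<epsilon>\<bar> \<le> 1" using elim t(1) by auto
        qed (use C(1) in simp_all)
        finally show "norm (g \<epsilon> t) \<le> A * R + 1 * C * (B * R)" .
      qed
    qed
    then show ?thesis by (rule exI)
  qed
  have "\<exists>K M. compact K \<and> K \<subseteq> UNIV \<and> (\<forall>\<^sub>F \<epsilon> in at_right 0. \<forall>t\<in>{0..T}. p \<epsilon> t \<in> K \<and> norm (g \<epsilon> t) \<le> M)"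
    by (rule primitive_on_family_bounded[OF open_UNIV primitive p_limit UNIV_I bound])
  then obtain K M where "\<forall>\<^sub>F \<epsilon> in at_right 0. \<forall>t\<in>{0..T}. p \<epsilon> t \<in> K \<and> norm (g \<epsilon> t) \<le> M"
    by (elim exE conjE)
  then have M: "\<forall>\<^sub>F \<epsilon> in at_right 0. \<forall>t\<in>{0..T}. norm (g \<epsilon> t) \<le> M"
    by (rule eventually_mono) simp
  have prim: "primitive_on T (\<lambda>t. hessian J (\<theta>0 t) *v p0 t) p0"
    by (rule primitive_on_limit(1)[OF primitive M p_limit g_limit])
  show ?thesis
  proof (rule primitive_on_has_vector_derivative[OF prim _ t])
    show "continuous_on {0..T} (\<lambda>t. hessian J (\<theta>0 t) *v p0 t)"
      by (intro continuous_on_matrix_vector primitive_on_continuous[OF prim]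
          continuous_on_compose2[OF C2_on_continuous(2)[OF J_C2] zeroth_order_state_continuous])
        (use \<theta>0_in in auto)
  qed
qed

text \<open>In the comparison of two values of the Hamiltonian the term \<open>- grad J\<close> cancels and the factor \<open>\<epsilon>\<close>
  of the control can be divided out. The resulting inequality between terms that converge survives in
  the limit.\<close>

lemma zeroth_order_control:
  assumes maximal: "\<And>\<epsilon>. \<epsilon> \<in> {0<..<\<epsilon>max} \<Longrightarrow>
      is_arg_max (hamiltonian J Jn \<epsilon> (\<theta> \<epsilon> t) (p \<epsilon> t)) (\<lambda>v. v \<in> U) (u \<epsilon> t)"
    and p_limit: "((\<lambda>\<epsilon>. p \<epsilon> t) \<longlongrightarrow> p0 t) (at_right 0)"
    and U: "closed U" and t: "t \<in> {0..T}"
  shows "is_arg_max (\<lambda>v. p0 t \<bullet> (v *\<^sub>R sq_grad Jn (\<theta>0 t))) (\<lambda>v. v \<in> U) (u0 t)"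
proof -
  have u0: "u0 t \<in> U"
  proof (rule Lim_in_closed_set[OF U _ _ control_limit[OF t]])
    show "\<forall>\<^sub>F \<epsilon> in at_right 0. u \<epsilon> t \<in> U"
      using eventually_small by eventually_elim (use controls t in auto)
  qed simp
  have le: "p0 t \<bullet> (v *\<^sub>R sq_grad Jn (\<theta>0 t)) \<le> p0 t \<bullet> (u0 t *\<^sub>R sq_grad Jn (\<theta>0 t))" if v: "v \<in> U" for v
  proof (rule tendsto_le)
    show "\<forall>\<^sub>F \<epsilon> in at_right 0. p \<epsilon> t \<bullet> (v *\<^sub>R sq_grad Jn (\<theta> \<epsilon> t)) \<le> p \<epsilon> t \<bullet> (u \<epsilon> t *\<^sub>R sq_grad Jn (\<theta> \<epsilon> t))"
      using eventually_small
    proof eventually_elim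
      case (elim \<epsilon>)
      then have "hamiltonian J Jn \<epsilon> (\<theta> \<epsilon> t) (p \<epsilon> t) v \<le> hamiltonian J Jn \<epsilon> (\<theta> \<epsilon> t) (p \<epsilon> t) (u \<epsilon> t)"
        using maximal[of \<epsilon>] v by (auto simp: is_arg_max_def not_less)
      then have "\<epsilon> * (v * (p \<epsilon> t \<bullet> sq_grad Jn (\<theta> \<epsilon> t))) \<le> \<epsilon> * (u \<epsilon> t * (p \<epsilon> t \<bullet> sq_grad Jn (\<theta> \<epsilon> t)))"
        by (simp add: hamiltonian_def control_field_def inner_add_right inner_diff_right mult.assoc)
      then show ?case using elim by simp
    qed
    show "((\<lambda>\<epsilon>. p \<epsilon> t \<bullet> (v *\<^sub>R sq_grad Jn (\<theta> \<epsilon> t))) \<longlongrightarrow> p0 t \<bullet> (v *\<^sub>R sq_grad Jn (\<theta>0 t))) (at_right 0)"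
      "((\<lambda>\<epsilon>. p \<epsilon> t \<bullet> (u \<epsilon> t *\<^sub>R sq_grad Jn (\<theta> \<epsilon> t))) \<longlongrightarrow> p0 t \<bullet> (u0 t *\<^sub>R sq_grad Jn (\<theta>0 t))) (at_right 0)"
      by (intro tendsto_intros p_limit control_limit t limit_along_states sq_grad_continuous(1)[OF Jn_C2])+
  qed simp
  show ?thesis unfolding is_arg_max_def
  proof (intro conjI u0 notI)
    assume "\<exists>v. v \<in> U \<and> p0 t \<bullet> (u0 t *\<^sub>R sq_grad Jn (\<theta>0 t)) < p0 t \<bullet> (v *\<^sub>R sq_grad Jn (\<theta>0 t))"
    then show False using le by (auto simp: not_le[symmetric])
  qed
qed

lemma cost_expansion:
  assumes \<phi>: "C2_on \<Theta> \<phi>"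
  shows "first_order_expansion (\<lambda>\<epsilon>. cost \<Theta> T \<theta>init J Jn \<phi> \<epsilon> (u \<epsilon>)) (\<phi> (\<theta>0 T)) (grad \<phi> (\<theta>0 T) \<bullet> \<theta>1 T)"
proof -
  have T: "T \<in> {0..T}" using T_pos by simp
  have "\<forall>\<^sub>F \<epsilon> in at_right 0. cost \<Theta> T \<theta>init J Jn \<phi> \<epsilon> (u \<epsilon>) = \<phi> (\<theta> \<epsilon> T)"
    using eventually_small
  proof eventually_elim
    case (elim \<epsilon>)
    then have "bounded (u \<epsilon> ` {0..T})" by (intro bounded_subset[OF U_bounded]) (use controls in auto)
    then show ?case
      using elim T_pos by (intro cost_eq[OF open_\<Theta> J_C2 Jn_C2 _ _ states]) auto
  qed
  then have "\<forall>\<^sub>F \<epsilon> in at_right 0. norm (cost \<Theta> T \<theta>init J Jn \<phi> \<epsilon> (u \<epsilon>) - (\<phi> (\<theta>0 T) + \<epsilon> *\<^sub>R (grad \<phi> (\<theta>0 T) \<bullet> \<theta>1 T)))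
      = norm (\<phi> (\<theta> \<epsilon> T) - (\<phi> (\<theta>0 T) + \<epsilon> *\<^sub>R (grad \<phi> (\<theta>0 T) \<bullet> \<theta>1 T)))"
    by eventually_elim simp
  moreover have "first_order_expansion (\<lambda>\<epsilon>. \<phi> (\<theta> \<epsilon> T)) (\<phi> (\<theta>0 T)) (grad \<phi> (\<theta>0 T) \<bullet> \<theta>1 T)"
    by (rule first_order_expansion_compose[OF open_\<Theta> \<theta>0_in[OF T] \<phi> expansion[OF T]])
  ultimately show ?thesis
    unfolding first_order_expansion_def by (simp only: landau_o.big.in_cong)
qed

end

section \<open>Expansion of the optimal solutions\<close>

theorem proposition2p1:
  fixes \<Theta> :: "(real^'p) set" and \<theta>init :: "real^'p"
    and T \<epsilon>max :: real and U :: "real set"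
    and Z1 Z2 :: "'x dataset" and noise :: "real list"
    and l :: "'o \<Rightarrow> real \<Rightarrow> real" and h :: "real^'p \<Rightarrow> 'x \<Rightarrow> 'o"
    and \<Phi> :: "'x dataset \<Rightarrow> real^'p \<Rightarrow> real"
    and J Jn :: "real^'p \<Rightarrow> real"
    and \<theta> p :: "real \<Rightarrow> real \<Rightarrow> real^'p" and u :: "real \<Rightarrow> real \<Rightarrow> real"
    and \<theta>0 \<theta>1 p0 p1 :: "real \<Rightarrow> real^'p" and u0 u1 :: "real \<Rightarrow> real"
  assumes data: "Z1 \<noteq> []" "length noise = length Z1"
    and J_eq: "J = emp_risk l h Z1"
    and Jn_eq: "Jn = emp_risk l h (perturb_labels Z1 noise)"
    and params: "open \<Theta>" "\<theta>init \<in> \<Theta>" "0 < T" "0 < \<epsilon>max"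
    and risk_C2: "C2_on \<Theta> J" "C2_on \<Theta> Jn"
    and U_compact: "compact U"
    and \<Phi>_C2: "C2_on \<Theta> (\<Phi> Z2)"
    and states_exist:
      "\<And>\<epsilon> v. \<epsilon> \<in> {0<..<\<epsilon>max} \<Longrightarrow> admissible T U v \<Longrightarrow> bounded (v ` {0..T}) \<Longrightarrow>
         \<exists>x. is_state \<Theta> T \<theta>init J Jn \<epsilon> v x \<and> bounded (x ` {0..T})"
    and optimal:
      "\<And>\<epsilon>. \<epsilon> \<in> {0<..<\<epsilon>max} \<Longrightarrow> optimal_control \<Theta> T \<theta>init J Jn (\<Phi> Z2) U \<epsilon> (u \<epsilon>)"
    and pontryagin:
      "\<And>\<epsilon>. \<epsilon> \<in> {0<..<\<epsilon>max} \<Longrightarrow>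
         pontryagin_conditions \<Theta> T \<theta>init J Jn (\<Phi> Z2) U \<epsilon> (\<theta> \<epsilon>) (p \<epsilon>) (u \<epsilon>)"
    and \<theta>_expansion: "\<And>t. t \<in> {0..T} \<Longrightarrow> first_order_expansion (\<lambda>\<epsilon>. \<theta> \<epsilon> t) (\<theta>0 t) (\<theta>1 t)"
    and p_expansion: "\<And>t. t \<in> {0..T} \<Longrightarrow> first_order_expansion (\<lambda>\<epsilon>. p \<epsilon> t) (p0 t) (p1 t)"
    and u_expansion: "\<And>t. t \<in> {0..T} \<Longrightarrow> first_order_expansion (\<lambda>\<epsilon>. u \<epsilon> t) (u0 t) (u1 t)"
    and \<theta>0_in: "\<And>t. t \<in> {0..T} \<Longrightarrow> \<theta>0 t \<in> \<Theta>"
  shows "first_order_expansion (\<lambda>\<epsilon>. cost \<Theta> T \<theta>init J Jn (\<Phi> Z2) \<epsilon> (u \<epsilon>))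
           (\<Phi> Z2 (\<theta>0 T)) (grad (\<Phi> Z2) (\<theta>0 T) \<bullet> \<theta>1 T) \<and>
         first_order_expansion (\<lambda>\<epsilon>. cost \<Theta> T \<theta>init J Jn (\<Phi> Z2) \<epsilon> (u \<epsilon>))
           (\<Phi> Z2 (\<theta>0 T)) (- (p0 T \<bullet> \<theta>1 T)) \<and>
         (\<forall>t\<in>{0..T}. (\<theta>0 has_vector_derivative - grad J (\<theta>0 t)) (at t within {0..T})) \<and>
         \<theta>0 0 = \<theta>init \<and>
         (\<forall>t\<in>{0..T}. (p0 has_vector_derivative hessian J (\<theta>0 t) *v p0 t) (at t within {0..T})) \<and>
         p0 T = - grad (\<Phi> Z2) (\<theta>0 T) \<and>
         (\<forall>t\<in>{0..T}. is_arg_max (\<lambda>v. p0 t \<bullet> (v *\<^sub>R sq_grad Jn (\<theta>0 t))) (\<lambda>v. v \<in> U) (u0 t)) \<and>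
         ae_ode_solution T (\<lambda>t x. - (hessian J (\<theta>0 t) *v x) + u0 t *\<^sub>R sq_grad Jn (\<theta>0 t)) \<theta>1 \<and>
         \<theta>1 0 = 0 \<and>
         first_order_expansion (\<lambda>\<epsilon>. \<theta> \<epsilon> T) (\<theta>0 T) (\<theta>1 T)"
proof -
  have maximal: "is_arg_max (hamiltonian J Jn \<epsilon> (\<theta> \<epsilon> t) (p \<epsilon> t)) (\<lambda>v. v \<in> U) (u \<epsilon> t)"
    if "\<epsilon> \<in> {0<..<\<epsilon>max}" "t \<in> {0..T}" for \<epsilon> t
    using pontryagin[OF that(1)] that(2) by (simp add: pontryagin_conditions_def)
  have states: "is_state \<Theta> T \<theta>init J Jn \<epsilon> (u \<epsilon>) (\<theta> \<epsilon>)" if "\<epsilon> \<in> {0<..<\<epsilon>max}" for \<epsilon>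
    using pontryagin[OF that] by (simp add: pontryagin_conditions_def)
  interpret perturbed_states \<Theta> T \<theta>init J Jn U \<epsilon>max \<theta> u \<theta>0 \<theta>1 u0
  proof
    show "u \<epsilon> t \<in> U" if "\<epsilon> \<in> {0<..<\<epsilon>max}" "t \<in> {0..T}" for \<epsilon> t
      using maximal[OF that] by (simp add: is_arg_max_def)
    show "((\<lambda>\<epsilon>. u \<epsilon> t) \<longlongrightarrow> u0 t) (at_right 0)" if "t \<in> {0..T}" for t
      by (rule first_order_expansion_tendsto[OF u_expansion[OF that]])
  qed (fact params risk_C2 compact_imp_bounded[OF U_compact] states \<theta>_expansion \<theta>0_in)+
  have T: "T \<in> {0..T}" using params by simp
  have p_limit: "((\<lambda>\<epsilon>. p \<epsilon> t) \<longlongrightarrow> p0 t) (at_right 0)" if "t \<in> {0..T}" for t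
    by (rule first_order_expansion_tendsto[OF p_expansion[OF that]])
  have costates: "ae_ode_solution T (\<lambda>t. costate_field J Jn \<epsilon> (u \<epsilon> t) (\<theta> \<epsilon> t)) (p \<epsilon>)"
    if "\<epsilon> \<in> {0<..<\<epsilon>max}" for \<epsilon>
    using pontryagin[OF that] by (simp add: pontryagin_conditions_def)
  have pT: "p0 T = - grad (\<Phi> Z2) (\<theta>0 T)"
  proof (rule tendsto_unique[OF _ p_limit[OF T]])
    have "((\<lambda>\<epsilon>. - grad (\<Phi> Z2) (\<theta> \<epsilon> T)) \<longlongrightarrow> - grad (\<Phi> Z2) (\<theta>0 T)) (at_right 0)"
      by (intro tendsto_intros limit_along_states T C2_on_continuous(1)[OF \<Phi>_C2])
    moreover have "\<forall>\<^sub>F \<epsilon> in at_right 0. p \<epsilon> T = - grad (\<Phi> Z2) (\<theta> \<epsilon> T)"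
      using eventually_small by eventually_elim (use pontryagin in \<open>auto simp: pontryagin_conditions_def\<close>)
    ultimately show "((\<lambda>\<epsilon>. p \<epsilon> T) \<longlongrightarrow> - grad (\<Phi> Z2) (\<theta>0 T)) (at_right 0)"
      by (simp only: tendsto_cong)
  qed simp
  note cost = cost_expansion[OF \<Phi>_C2]
  have slope: "- (p0 T \<bullet> \<theta>1 T) = grad (\<Phi> Z2) (\<theta>0 T) \<bullet> \<theta>1 T" by (simp add: pT)
  show ?thesis
    unfolding slope
  proof (intro conjI ballI)
    fix t assume t: "t \<in> {0..T}"
    show "(\<theta>0 has_vector_derivative - grad J (\<theta>0 t)) (at t within {0..T})"
      by (rule zeroth_order_state_ode[OF t])
    show "(p0 has_vector_derivative hessian J (\<theta>0 t) *v p0 t) (at t within {0..T})"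
      by (rule zeroth_order_costate[OF costates p_limit t])
    show "is_arg_max (\<lambda>v. p0 t \<bullet> (v *\<^sub>R sq_grad Jn (\<theta>0 t))) (\<lambda>v. v \<in> U) (u0 t)"
      by (rule zeroth_order_control[of t p p0, OF maximal[OF _ t] p_limit[OF t] compact_imp_closed[OF U_compact] t])
  qed (fact cost initial_values pT first_order_state expansion[OF T])+
qed

end
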